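(* Let $k$ be an infinite field, and let $p:=\operatorname{char}k$ if this is positive and $p:=\infty$ otherwise. Let $G$ be a finite group and assume $p>\beta_k(G)$. Then the regular representation of $G$ over $k$ has universal invariants.
   Context: For an $\mathbb N$-graded commutative ring $A=\bigoplus_{d\ge0}A_d$ put $\beta(A):=\inf\{n\in\mathbb N\mid A\text{ is generated as a ring by }\bigoplus_{d=0}^nA_d\}$ (with $\inf\emptyset=\infty$). $\beta_k(G):=\sup_A\beta(A^G)\in\mathbb N\cup\{\infty\}$, where $A$ runs through all $\mathbb N$-graded commutative $k$-algebras with a $G$-action (by degree-preserving $k$-algebra automorphisms) and with $\beta(A)\le1$. If $\operatorname{char}k=0$, then $\beta_k(G)$ is finite and the condition $p=\infty>\beta_k(G)$ always holds. $k[W]$ denotes the ring of polynomial functions on a finite dimensional $G$-module $W$ over $k$. For a subset $S\subseteq k[W]$, $\operatorname{Pol}^W(S)$ is the $\operatorname{Aut}^G(W)$-submodule of $k[W]$ generated by $S$, where $\operatorname{Aut}^G(W)$ is the group of $G$-equivariant linear automorphisms of $W$. If $V\subseteq W$ is a submodule, $\operatorname{Res}_V(S)$ is the set of restrictions to $V$ of the elements of $S\subseteq k[W]$. If $U$ is a quotient of $W$, $\operatorname{Ext}_U^W(S)$ is the set of pullbacks to $W$ of the elements of $S\subseteq k[U]$. A finite dimensional $G$-module $U$ has universal invariants if for every finite dimensional $G$-module $V$ and every generating set $S$ of the $k$-algebra $k[U]^G$, the set $\operatorname{Res}_V\operatorname{Pol}^{U\oplus V}\operatorname{Ext}_U^{U\oplus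 V}(S)$ generates the $k$-algebra $k[V]^G$ (here $U$ is the quotient and $V$ the submodule of $U\oplus V$ given by the direct sum decomposition). *)

theory Defs
  imports
    "Jordan_Normal_Form.VS_Connect"
    "HOL-Algebra.Group_Action"
    "HOL-Algebra.Generated_Rings"
    "HOL-Library.Extended_Nat"
begin

text \<open>
  The ground field is a type \<open>'k\<close> of class \<open>field\<close>; \<^term>\<open>class_ring\<close> is the same field as a
  record. Groups, vector spaces and algebras are records with a carrier, and functions on a
  carrier are extensional (i.e. \<^const>\<open>undefined\<close> outside of it), so that two functions are equal
  iff they agree on the carrier.
\<close>

subsection \<open>Graded algebras with a group action and the number \<open>\<beta>\<^sub>k(G)\<close>\<close>

definition nat_graded_algebra ::
  "('k::field, 'a, 'c) module_scheme \<Rightarrow> (nat \<Rightarrow> 'a set) \<Rightarrow> bool" where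
  "nat_graded_algebra A gr \<longleftrightarrow>
     algebra class_ring A \<and>
     (\<forall>d. Module.submodule (gr d) class_ring A) \<and>
     (\<forall>a\<in>carrier A. \<exists>!c. (\<forall>d. c d \<in> gr d) \<and> finite {d. c d \<noteq> \<zero>\<^bsub>A\<^esub>} \<and>
        a = finsum A c {d. c d \<noteq> \<zero>\<^bsub>A\<^esub>}) \<and>
     \<one>\<^bsub>A\<^esub> \<in> gr 0 \<and>
     (\<forall>i j. \<forall>a\<in>gr i. \<forall>b\<in>gr j. a \<otimes>\<^bsub>A\<^esub> b \<in> gr (i + j))"

text \<open>\<open>\<beta>(A)\<close>; in \<^typ>\<open>enat\<close> the infimum of the empty set is \<open>\<infinity>\<close>.\<close>

definition gen_degree :: "('a, 'c) ring_scheme \<Rightarrow> (nat \<Rightarrow> 'a set) \<Rightarrow> enat" where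
  "gen_degree A gr =
     Inf {enat n | n. generate_ring A {finsum A c {..n} | c. \<forall>d\<le>n. c d \<in> gr d} = carrier A}"

definition graded_action ::
  "('g, 'b) monoid_scheme \<Rightarrow> ('k::field, 'a, 'c) module_scheme \<Rightarrow> (nat \<Rightarrow> 'a set)
    \<Rightarrow> ('g \<Rightarrow> 'a \<Rightarrow> 'a) \<Rightarrow> bool" where
  "graded_action G A gr \<rho> \<longleftrightarrow>
     group_action G (carrier A) \<rho> \<and>
     (\<forall>g\<in>carrier G. \<rho> g \<in> Ring.ring_hom A A \<and> \<rho> g \<in> LinearCombinations.module_hom class_ring A A \<and>
        (\<forall>d. \<rho> g ` gr d \<subseteq> gr d))"

definition fixed_points :: "('g, 'b) monoid_scheme \<Rightarrow> 'a set \<Rightarrow> ('g \<Rightarrow> 'a \<Rightarrow> 'a) \<Rightarrow> 'a set" where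
  "fixed_points G E \<rho> = {a \<in> E. \<forall>g\<in>carrier G. \<rho> g a = a}"

definition fixed_gen_degree ::
  "('g, 'b) monoid_scheme \<Rightarrow> ('a, 'c) ring_scheme \<Rightarrow> (nat \<Rightarrow> 'a set) \<Rightarrow> ('g \<Rightarrow> 'a \<Rightarrow> 'a)
    \<Rightarrow> enat" where
  "fixed_gen_degree G A gr \<rho> =
     gen_degree (A\<lparr>carrier := fixed_points G (carrier A) \<rho>\<rparr>) (\<lambda>d. fixed_points G (gr d) \<rho>)"

text \<open>
  The supremum over all algebras \<open>A\<close> has to be taken inside some type that contains their
  carriers. For infinite \<open>k\<close> and finite \<open>G\<close> the type \<open>(nat \<Rightarrow> 'k) \<Rightarrow> 'k\<close> is large enough: if a
  homogeneous invariant \<open>a\<close> of some \<open>A\<close> is not generated by invariants of degree at most \<open>n\<close>, this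
  stays so in the \<open>k\<close>-subalgebra generated by the \<open>G\<close>-orbits of finitely many elements of
  \<open>A\<^sub>0 \<union> A\<^sub>1\<close> that generate a subring containing \<open>a\<close>, and this subalgebra has at most \<open>|k|\<close> elements.
  (A smaller supremum would in any case only weaken a hypothesis \<open>p > \<beta>\<^sub>k(G)\<close>.)
\<close>

definition noether_number :: "'k::field itself \<Rightarrow> ('g, 'b) monoid_scheme \<Rightarrow> enat" where
  "noether_number _ G =
     Sup {fixed_gen_degree G A gr \<rho> | (A :: ('k, (nat \<Rightarrow> 'k) \<Rightarrow> 'k) module) gr \<rho>.
       nat_graded_algebra A gr \<and> graded_action G A gr \<rho> \<and> gen_degree A gr \<le> 1}"


subsection \<open>Finite dimensional \<open>G\<close>-modules\<close>

definition fd_G_module ::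
  "('g, 'b) monoid_scheme \<Rightarrow> ('k::field, 'w, 'c) module_scheme \<Rightarrow> ('g \<Rightarrow> 'w \<Rightarrow> 'w) \<Rightarrow> bool" where
  "fd_G_module G W \<rho> \<longleftrightarrow>
     vectorspace class_ring W \<and> vectorspace.fin_dim class_ring W \<and>
     group_action G (carrier W) \<rho> \<and>
     (\<forall>g\<in>carrier G. linear_map class_ring W W (\<rho> g))"

definition direct_sum_action ::
  "('k::field, 'u) module \<Rightarrow> ('g \<Rightarrow> 'u \<Rightarrow> 'u) \<Rightarrow> ('k, 'v) module \<Rightarrow> ('g \<Rightarrow> 'v \<Rightarrow> 'v)
    \<Rightarrow> 'g \<Rightarrow> 'u \<times> 'v \<Rightarrow> 'u \<times> 'v" where
  "direct_sum_action U \<rho> V \<sigma> g =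
     (\<lambda>w\<in>carrier (direct_sum U V). (\<rho> g (fst w), \<sigma> g (snd w)))"

definition G_Aut ::
  "('g, 'b) monoid_scheme \<Rightarrow> ('k::field, 'w, 'c) module_scheme \<Rightarrow> ('g \<Rightarrow> 'w \<Rightarrow> 'w)
    \<Rightarrow> ('w \<Rightarrow> 'w) set" where
  "G_Aut G W \<rho> =
     {\<alpha> \<in> Bij (carrier W). linear_map class_ring W W \<alpha> \<and>
        (\<forall>g\<in>carrier G. \<forall>w\<in>carrier W. \<alpha> (\<rho> g w) = \<rho> g (\<alpha> w))}"

text \<open>
  The regular representation \<open>k[G]\<close>: a function \<open>f\<close> on \<open>G\<close> stands for \<open>\<Sum>x\<in>G. f x \<cdot> x\<close>, and \<open>g\<close> acts
  by left multiplication.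
\<close>

definition regular_module :: "('g, 'b) monoid_scheme \<Rightarrow> ('k::field, 'g \<Rightarrow> 'k) module" where
  "regular_module G = ring.func_space class_ring (carrier G)"

definition regular_action :: "('g, 'b) monoid_scheme \<Rightarrow> 'g \<Rightarrow> ('g \<Rightarrow> 'k::field) \<Rightarrow> ('g \<Rightarrow> 'k)" where
  "regular_action G g =
     (\<lambda>f\<in>carrier (regular_module G). \<lambda>x\<in>carrier G. f (inv\<^bsub>G\<^esub> g \<otimes>\<^bsub>G\<^esub> x))"


subsection \<open>Polynomial functions and universal invariants\<close>

text \<open>The \<open>k\<close>-algebra of functions on \<open>X\<close> generated by \<open>S\<close>.\<close>

inductive_set alg_gen :: "'w set \<Rightarrow> ('w \<Rightarrow> 'k::field) set \<Rightarrow> ('w \<Rightarrow> 'k) set"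
  for X S where
  const: "(\<lambda>w\<in>X. c) \<in> alg_gen X S"
| incl: "f \<in> S \<Longrightarrow> f \<in> alg_gen X S"
| add: "f \<in> alg_gen X S \<Longrightarrow> h \<in> alg_gen X S \<Longrightarrow> (\<lambda>w\<in>X. f w + h w) \<in> alg_gen X S"
| mult: "f \<in> alg_gen X S \<Longrightarrow> h \<in> alg_gen X S \<Longrightarrow> (\<lambda>w\<in>X. f w * h w) \<in> alg_gen X S"

definition linear_forms :: "('k::field, 'w, 'c) module_scheme \<Rightarrow> ('w \<Rightarrow> 'k) set" where
  "linear_forms W =
     {\<xi> \<in> extensional (carrier W).
        (\<forall>v\<in>carrier W. \<forall>w\<in>carrier W. \<xi> (v \<oplus>\<^bsub>W\<^esub> w) = \<xi> v + \<xi> w) \<and>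
        (\<forall>c. \<forall>w\<in>carrier W. \<xi> (c \<odot>\<^bsub>W\<^esub> w) = c * \<xi> w)}"

definition poly_funs :: "('k::field, 'w, 'c) module_scheme \<Rightarrow> ('w \<Rightarrow> 'k) set" where
  "poly_funs W = alg_gen (carrier W) (linear_forms W)"

definition poly_invariants ::
  "('g, 'b) monoid_scheme \<Rightarrow> ('k::field, 'w, 'c) module_scheme \<Rightarrow> ('g \<Rightarrow> 'w \<Rightarrow> 'w)
    \<Rightarrow> ('w \<Rightarrow> 'k) set" where
  "poly_invariants G W \<rho> =
     {f \<in> poly_funs W. \<forall>g\<in>carrier G. \<forall>w\<in>carrier W. f (\<rho> (inv\<^bsub>G\<^esub> g) w) = f w}"

text \<open>
  \<open>Pol\<^sup>W(S)\<close>: the smallest linear subspace containing \<open>S\<close> that is stable under the action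
  \<open>(\<alpha> \<cdot> f)(w) = f (\<alpha>\<^sup>-\<^sup>1 w)\<close> of the \<open>G\<close>-equivariant automorphisms \<open>\<alpha>\<close> of \<open>W\<close>.
\<close>

inductive_set Pol ::
  "('g, 'b) monoid_scheme \<Rightarrow> ('k::field, 'w, 'c) module_scheme \<Rightarrow> ('g \<Rightarrow> 'w \<Rightarrow> 'w)
    \<Rightarrow> ('w \<Rightarrow> 'k) set \<Rightarrow> ('w \<Rightarrow> 'k) set"
  for G W \<rho> S where
  incl: "f \<in> S \<Longrightarrow> f \<in> Pol G W \<rho> S"
| zero: "(\<lambda>w\<in>carrier W. 0) \<in> Pol G W \<rho> S"
| add: "f \<in> Pol G W \<rho> S \<Longrightarrow> h \<in> Pol G W \<rho> S \<Longrightarrow> (\<lambda>w\<in>carrier W. f w + h w) \<in> Pol G W \<rho> S"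
| smult: "f \<in> Pol G W \<rho> S \<Longrightarrow> (\<lambda>w\<in>carrier W. c * f w) \<in> Pol G W \<rho> S"
| act: "f \<in> Pol G W \<rho> S \<Longrightarrow> \<alpha> \<in> G_Aut G W \<rho> \<Longrightarrow>
    (\<lambda>w\<in>carrier W. f (inv_into (carrier W) \<alpha> w)) \<in> Pol G W \<rho> S"

text \<open>\<open>Res\<^sub>V\<close> and \<open>Ext\<^sub>U\<close> for the summand \<open>V\<close> and the quotient \<open>U\<close> of \<open>U \<oplus> V\<close>.\<close>

definition Res ::
  "('k::field, 'u) module \<Rightarrow> ('k, 'v) module \<Rightarrow> ('u \<times> 'v \<Rightarrow> 'k) set \<Rightarrow> ('v \<Rightarrow> 'k) set" where
  "Res U V S = (\<lambda>f. \<lambda>v\<in>carrier V. f (inj2 U V v)) ` S"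

definition Ext ::
  "('k::field, 'u) module \<Rightarrow> ('k, 'v) module \<Rightarrow> ('u \<Rightarrow> 'k) set \<Rightarrow> ('u \<times> 'v \<Rightarrow> 'k) set" where
  "Ext U V S = (\<lambda>f. \<lambda>w\<in>carrier (direct_sum U V). f (fst w)) ` S"

text \<open>
  The type argument is the type whose subsets serve as carriers of the modules \<open>V\<close>; it is meant
  to be left as a free type variable in theorems.
\<close>

definition has_universal_invariants ::
  "'v itself \<Rightarrow> ('g, 'b) monoid_scheme \<Rightarrow> ('k::field, 'u) module \<Rightarrow> ('g \<Rightarrow> 'u \<Rightarrow> 'u) \<Rightarrow> bool" where
  "has_universal_invariants _ G U \<rho> \<longleftrightarrow>
     fd_G_module G U \<rho> \<and>
     (\<forall>(V :: ('k, 'v) module) \<sigma> S.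
        fd_G_module G V \<sigma> \<longrightarrow>
        alg_gen (carrier U) S = poly_invariants G U \<rho> \<longrightarrow>
        alg_gen (carrier V)
          (Res U V (Pol G (direct_sum U V) (direct_sum_action U \<rho> V \<sigma>) (Ext U V S)))
        = poly_invariants G V \<sigma>)"

end

theory Submission
  imports Defs "HOL-Library.Function_Algebras"
    "HOL-Computational_Algebra.Formal_Power_Series"
begin

text \<open>
  If \<open>|G|\<close> were zero in \<open>k\<close>, let \<open>\<epsilon>\<close> span a square zero ideal \<open>k[G] \<epsilon>\<close> and let \<open>A\<^sub>d\<close> consist of
  all \<open>a + b \<epsilon>\<close> with \<open>a \<in> k\<close>, \<open>b \<in> k[G]\<close> whose coefficients add up to \<open>d a\<close>. This graded algebra is
  generated in degrees \<open>0\<close> and \<open>1\<close>. Its invariants of degree \<open>d\<close> have constant \<open>b\<close>, hence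
  \<open>d a = 0\<close>, and so \<open>a = 0\<close> if \<open>0 < d < p\<close>. The invariant \<open>1 \<in> A\<^sub>p\<close> is therefore not generated in
  degrees below \<open>p\<close>, contradicting \<open>p > \<beta>\<^sub>k(G)\<close>.

  So \<open>|G|\<close> is invertible and \<open>k[V]\<^sup>G\<close> is generated by averages of products of \<open>d < p\<close> linear forms
  (any \<open>d\<close> in characteristic zero). As \<open>d!\<close> is invertible, polarization writes these products as
  combinations of powers \<open>l\<^sup>d\<close>. The sum of the \<open>G\<close>-translates of \<open>l\<^sup>d\<close> is the pullback of the power sum
  \<open>\<Sum>\<^sub>x u(x)\<^sup>d \<in> k[U]\<^sup>G\<close>, \<open>U\<close> the regular representation, under the equivariant map
  \<open>\<phi>: V \<rightarrow> U\<close>, \<open>\<phi>(v)(x) = l(x\<^sup>-\<^sup>1 v)\<close>. Finally, \<open>s \<circ> \<phi>\<close> for a generator \<open>s\<close> of \<open>k[U]\<^sup>G\<close> is the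
  restriction to \<open>V\<close> of the translate of \<open>s\<close> under the automorphism \<open>(u, v) \<mapsto> (u + \<phi>(v), v)\<close>.
\<close>

subsection \<open>Graded algebras from graded pieces\<close>

hide_const (open) UnivPoly.up_ring.coeff UnivPoly.up_ring.monom
  Modules.module Multiset.mult Polynomial.smult

text \<open>Generation in low degrees is used below only through such sets: a subring that contains
  the low invariants contains all of them.\<close>

definition subring_set :: "'a::ring_1 set \<Rightarrow> bool" where
  "subring_set Q \<longleftrightarrow> 1 \<in> Q \<and> (\<forall>a\<in>Q. - a \<in> Q \<and> (\<forall>b\<in>Q. a + b \<in> Q \<and> a * b \<in> Q))"

text \<open>
  The data describe the graded algebra \<open>\<Oplus>\<^sub>d M d\<close>, realised as the polynomials over \<^typ>\<open>'r\<close> whose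
  coefficient of degree \<open>d\<close> lies in \<open>M d\<close>; \<open>\<Phi>\<close> transports it to the type over which
  \<^const>\<open>noether_number\<close> takes its supremum.
\<close>

locale graded_action_data = group G
  for G :: "('g, 'b) monoid_scheme" (structure) +
  fixes scal :: "'k::field \<Rightarrow> 'r::comm_ring_1"
    and M :: "nat \<Rightarrow> 'r set"
    and \<tau> :: "'g \<Rightarrow> 'r \<Rightarrow> 'r"
    and \<Phi> :: "'r poly \<Rightarrow> 'x"
  assumes scal_1: "scal 1 = 1"
    and scal_add: "scal (c + c') = scal c + scal c'"
    and scal_mult: "scal (c * c') = scal c * scal c'"
    and scal_mem: "scal c \<in> M 0"
    and M_0: "0 \<in> M d"
    and M_add: "a \<in> M d \<Longrightarrow> b \<in> M d \<Longrightarrow> a + b \<in> M d"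
    and M_mult: "a \<in> M i \<Longrightarrow> b \<in> M j \<Longrightarrow> a * b \<in> M (i + j)"
    and M_gen: "a \<in> M (Suc d) \<Longrightarrow> (\<And>x y. x \<in> M 1 \<Longrightarrow> y \<in> M d \<Longrightarrow> x * y \<in> Q) \<Longrightarrow>
      (\<And>x y. x \<in> Q \<Longrightarrow> y \<in> Q \<Longrightarrow> x + y \<in> Q) \<Longrightarrow> a \<in> Q"
    and act_mem: "g \<in> carrier G \<Longrightarrow> a \<in> M d \<Longrightarrow> \<tau> g a \<in> M d"
    and act_add: "g \<in> carrier G \<Longrightarrow> \<tau> g (a + b) = \<tau> g a + \<tau> g b"
    and act_mult: "g \<in> carrier G \<Longrightarrow> \<tau> g (a * b) = \<tau> g a * \<tau> g b"
    and act_scal: "g \<in> carrier G \<Longrightarrow> \<tau> g (scal c) = scal c"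
    and act_one: "a \<in> M d \<Longrightarrow> \<tau> \<one> a = a"
    and act_comp: "g \<in> carrier G \<Longrightarrow> h \<in> carrier G \<Longrightarrow> a \<in> M d \<Longrightarrow> \<tau> (g \<otimes> h) a = \<tau> g (\<tau> h a)"
    and inj_code: "inj \<Phi>"
begin

definition polys :: "'r poly set" where
  "polys = {F. \<forall>d. coeff F d \<in> M d}"

abbreviation decode :: "'x \<Rightarrow> 'r poly" where
  "decode \<equiv> inv_into UNIV \<Phi>"

definition alg :: "('k, 'x) module" where
  "alg = \<lparr>carrier = \<Phi> ` polys, mult = (\<lambda>x y. \<Phi> (decode x * decode y)), one = \<Phi> 1, zero = \<Phi> 0,
     add = (\<lambda>x y. \<Phi> (decode x + decode y)),
     smult = (\<lambda>c x. \<Phi> (Polynomial.smult (scal c) (decode x)))\<rparr>"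

definition gr :: "nat \<Rightarrow> 'x set" where
  "gr d = (\<lambda>a. \<Phi> (monom a d)) ` M d"

text \<open>The restriction to the carrier makes each map extensional, as membership in
  \<open>Bij\<close> requires.\<close>

definition act :: "'g \<Rightarrow> 'x \<Rightarrow> 'x" where
  "act g = (\<lambda>x\<in>\<Phi> ` polys. \<Phi> (map_poly (\<tau> g) (decode x)))"

lemma decode_code [simp]: "decode (\<Phi> F) = F"
  using inj_code by simp

lemma code_eq_iff [simp]: "\<Phi> F = \<Phi> H \<longleftrightarrow> F = H"
  using inj_code by (simp add: inj_eq)

lemma alg_simps [simp]:
  "carrier alg = \<Phi> ` polys" "x \<otimes>\<^bsub>alg\<^esub> y = \<Phi> (decode x * decode y)" "\<one>\<^bsub>alg\<^esub> = \<Phi> 1"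
  "\<zero>\<^bsub>alg\<^esub> = \<Phi> 0" "x \<oplus>\<^bsub>alg\<^esub> y = \<Phi> (decode x + decode y)"
  "c \<odot>\<^bsub>alg\<^esub> x = \<Phi> (Polynomial.smult (scal c) (decode x))"
  by (simp_all add: alg_def)

lemma scal_0: "scal 0 = 0"
  using scal_add[of 0 0] by simp

lemma scal_neg: "scal (- c) = - scal c"
  using scal_add[of c "- c"] by (simp add: scal_0 minus_unique)

lemma M_1: "1 \<in> M 0"
  using scal_mem[of 1] by (simp add: scal_1)

lemma M_scal: "a \<in> M d \<Longrightarrow> scal c * a \<in> M d"
  using M_mult[OF scal_mem] by fastforce

lemma M_neg: "a \<in> M d \<Longrightarrow> - a \<in> M d"
  using M_scal[of a d "- 1"] by (simp add: scal_neg scal_1)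

lemma M_sum: "(\<And>i. i \<in> I \<Longrightarrow> f i \<in> M d) \<Longrightarrow> sum f I \<in> M d"
  by (induction I rule: infinite_finite_induct) (auto intro: M_0 M_add)

lemma act_0: "g \<in> carrier G \<Longrightarrow> \<tau> g 0 = 0"
  using act_add[of g 0 0] by simp

lemma act_1: "g \<in> carrier G \<Longrightarrow> \<tau> g 1 = 1"
  using act_scal[of g 1] by (simp add: scal_1)

lemma act_sum: "g \<in> carrier G \<Longrightarrow> \<tau> g (sum f I) = (\<Sum>i\<in>I. \<tau> g (f i))"
  by (induction I rule: infinite_finite_induct) (auto simp: act_0 act_add)

lemma act_neg: "g \<in> carrier G \<Longrightarrow> \<tau> g (- a) = - \<tau> g a"
  using act_add[of g a "- a"] by (simp add: act_0 minus_unique)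

lemma polys_0: "0 \<in> polys"
  by (simp add: polys_def M_0)

lemma polys_1: "1 \<in> polys"
  by (simp add: polys_def M_0 M_1)

lemma polys_add: "F \<in> polys \<Longrightarrow> H \<in> polys \<Longrightarrow> F + H \<in> polys"
  by (simp add: polys_def M_add)

lemma polys_neg: "F \<in> polys \<Longrightarrow> - F \<in> polys"
  by (simp add: polys_def M_neg)

lemma polys_mult:
  assumes "F \<in> polys" "H \<in> polys"
  shows "F * H \<in> polys"
proof -
  have "coeff F i * coeff H (n - i) \<in> M n" if "i \<le> n" for i n
    using M_mult[of "coeff F i" i "coeff H (n - i)" "n - i"] assms that by (simp add: polys_def)
  then show ?thesis
    by (auto simp: polys_def coeff_mult intro: M_sum)
qed

lemma polys_smult: "F \<in> polys \<Longrightarrow> Polynomial.smult (scal c) F \<in> polys"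
  by (simp add: polys_def M_scal)

lemma polys_monom: "a \<in> M d \<Longrightarrow> monom a d \<in> polys"
  by (simp add: polys_def M_0)

text \<open>Stated for any subring \<open>P\<close> of polynomials, since it is applied both to
  \<open>polys\<close> and to the invariants \<open>fixed_polys\<close>.\<close>

lemma cring_alg_carrier:
  assumes P: "0 \<in> P" "1 \<in> P" "\<And>F H. F \<in> P \<Longrightarrow> H \<in> P \<Longrightarrow> F + H \<in> P"
    "\<And>F H. F \<in> P \<Longrightarrow> H \<in> P \<Longrightarrow> F * H \<in> P" "\<And>F. F \<in> P \<Longrightarrow> - F \<in> P"
  shows "cring (alg\<lparr>carrier := \<Phi> ` P\<rparr>)"
proof (rule cringI)
  show "abelian_group (alg\<lparr>carrier := \<Phi> ` P\<rparr>)"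
  proof (rule abelian_groupI)
    fix x assume "x \<in> carrier (alg\<lparr>carrier := \<Phi> ` P\<rparr>)"
    then obtain F where F: "F \<in> P" "x = \<Phi> F" by auto
    show "\<exists>y\<in>carrier (alg\<lparr>carrier := \<Phi> ` P\<rparr>). y \<oplus>\<^bsub>alg\<lparr>carrier := \<Phi> ` P\<rparr>\<^esub> x = \<zero>\<^bsub>alg\<lparr>carrier := \<Phi> ` P\<rparr>\<^esub>"
      using F P by (intro bexI[of _ "\<Phi> (- F)"]) auto
  qed (use P in \<open>auto simp: add_ac\<close>)
  show "comm_monoid (alg\<lparr>carrier := \<Phi> ` P\<rparr>)"
    by (rule comm_monoidI) (use P in \<open>auto simp: mult_ac\<close>)
qed (auto simp: ring_distribs)

lemma a_inv_alg_carrier: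
  assumes "cring (alg\<lparr>carrier := \<Phi> ` P\<rparr>)" "F \<in> P" "- F \<in> P"
  shows "\<ominus>\<^bsub>alg\<lparr>carrier := \<Phi> ` P\<rparr>\<^esub> \<Phi> F = \<Phi> (- F)"
proof -
  interpret cring "alg\<lparr>carrier := \<Phi> ` P\<rparr>" by fact
  show ?thesis by (rule minus_equality) (use assms(2,3) in auto)
qed

lemma finsum_alg_carrier:
  assumes "cring (alg\<lparr>carrier := \<Phi> ` P\<rparr>)" "finite I" "\<And>i. i \<in> I \<Longrightarrow> f i \<in> \<Phi> ` P"
  shows "finsum (alg\<lparr>carrier := \<Phi> ` P\<rparr>) f I = \<Phi> (\<Sum>i\<in>I. decode (f i))"
proof -
  interpret cring "alg\<lparr>carrier := \<Phi> ` P\<rparr>" by fact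
  show ?thesis
    using assms(2,3) by (induction I rule: finite_induct) (auto simp: Pi_def)
qed

lemma cring_alg: "cring alg"
  using cring_alg_carrier[of polys] polys_0 polys_1 polys_add polys_mult polys_neg
  by (simp add: alg_def)

lemma a_inv_alg: "F \<in> polys \<Longrightarrow> \<ominus>\<^bsub>alg\<^esub> \<Phi> F = \<Phi> (- F)"
  using a_inv_alg_carrier[of polys F] cring_alg polys_neg by (simp add: alg_def)

lemma finsum_alg:
  "finite I \<Longrightarrow> (\<And>i. i \<in> I \<Longrightarrow> f i \<in> \<Phi> ` polys) \<Longrightarrow> finsum alg f I = \<Phi> (\<Sum>i\<in>I. decode (f i))"
  using finsum_alg_carrier[of polys I f] cring_alg by (simp add: alg_def)

lemma algebra_alg: "algebra class_ring alg"
proof (rule algebraI)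
  show "cring (class_ring :: 'k ring)" by (rule class_cring.is_cring)
  show "cring alg" by (rule cring_alg)
qed (auto simp: polys_smult scal_add scal_mult scal_1 smult_add_left smult_add_right)

lemma decode_gr: "x \<in> gr d \<Longrightarrow> decode x = monom (coeff (decode x) d) d"
  by (auto simp: gr_def)

lemma gr_subset: "gr d \<subseteq> \<Phi> ` polys"
  by (auto simp: gr_def intro: polys_monom)

lemma poly_eq_sum_monom:
  fixes F :: "'s::comm_monoid_add poly"
  assumes "finite I" "\<And>d. d \<notin> I \<Longrightarrow> coeff F d = 0"
  shows "F = (\<Sum>d\<in>I. monom (coeff F d) d)"
proof (rule poly_eqI)
  fix n
  show "coeff F n = coeff (\<Sum>d\<in>I. monom (coeff F d) d) n"
    using assms by (simp add: coeff_sum)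
qed

lemma graded_alg: "nat_graded_algebra alg gr"
  unfolding nat_graded_algebra_def
proof (intro conjI allI ballI)
  show "algebra class_ring alg" by (rule algebra_alg)
  interpret algebra class_ring alg by (rule algebra_alg)
  show "Module.submodule (gr d) class_ring alg" for d
  proof (rule submoduleI)
    show "gr d \<subseteq> carrier alg" using gr_subset by simp
    show "\<zero>\<^bsub>alg\<^esub> \<in> gr d" by (auto simp: gr_def intro!: image_eqI[of _ _ 0] M_0)
    show "\<ominus>\<^bsub>alg\<^esub> x \<in> gr d" if "x \<in> gr d" for x
      using that by (auto simp: gr_def a_inv_alg polys_monom minus_monom M_neg)
    show "x \<oplus>\<^bsub>alg\<^esub> y \<in> gr d" if "x \<in> gr d" "y \<in> gr d" for x y
      using that by (auto simp: gr_def add_monom M_add)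
    show "c \<odot>\<^bsub>alg\<^esub> x \<in> gr d" if "x \<in> gr d" for c x
      using that by (auto simp: gr_def smult_monom M_scal)
  qed
  show "\<one>\<^bsub>alg\<^esub> \<in> gr 0"
    using M_1 by (simp add: gr_def monom_0 image_iff one_pCons)
  show "a \<otimes>\<^bsub>alg\<^esub> b \<in> gr (i + j)" if "a \<in> gr i" "b \<in> gr j" for i j a b
    using that M_mult by (auto simp: gr_def mult_monom)
  fix a assume "a \<in> carrier alg"
  then obtain F where F: "F \<in> polys" "a = \<Phi> F" by auto
  define c where "c d = \<Phi> (monom (coeff F d) d)" for d
  have fin: "finite {d. coeff F d \<noteq> 0}"
    using MOST_coeff_eq_0[of F] by (simp add: eventually_cofinite)
  have eq: "{d. c d \<noteq> \<zero>\<^bsub>alg\<^esub>} = {d. coeff F d \<noteq> 0}"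
    by (simp add: c_def)
  have c: "c d \<in> gr d" for d
    using F by (auto simp: gr_def polys_def c_def)
  have "finsum alg c {d. coeff F d \<noteq> 0} = \<Phi> (\<Sum>d | coeff F d \<noteq> 0. decode (c d))"
    using c gr_subset by (intro finsum_alg fin) blast
  also have "(\<Sum>d | coeff F d \<noteq> 0. decode (c d)) = F"
    using poly_eq_sum_monom[OF fin, of F] by (simp add: c_def)
  finally have sum: "a = finsum alg c {d. c d \<noteq> \<zero>\<^bsub>alg\<^esub>}"
    using F eq by simp
  have unique: "c' = c" if c': "\<forall>d. c' d \<in> gr d" "finite {d. c' d \<noteq> \<zero>\<^bsub>alg\<^esub>}"
    "a = finsum alg c' {d. c' d \<noteq> \<zero>\<^bsub>alg\<^esub>}" for c'
  proof
    fix d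
    have "a = \<Phi> (\<Sum>e | c' e \<noteq> \<Phi> 0. decode (c' e))"
      using c' gr_subset by (subst c'(3), subst finsum_alg) auto
    then have "coeff F d = (\<Sum>e | c' e \<noteq> \<Phi> 0. coeff (decode (c' e)) d)"
      using F by (simp add: coeff_sum)
    \<comment> \<open>Each \<open>c' e\<close> encodes a monomial of degree \<open>e\<close>, so
      only \<open>e = d\<close> contributes to the coefficient at \<open>d\<close>; this forces
      uniqueness.\<close>
    also have "\<dots> = (\<Sum>e | c' e \<noteq> \<Phi> 0. if e = d then coeff (decode (c' d)) d else 0)"
      using c'(1) decode_gr by (intro sum.cong) (metis coeff_monom)+
    also have "\<dots> = (if c' d \<noteq> \<Phi> 0 then coeff (decode (c' d)) d else 0)"
      using c'(2) by simp
    also have "\<dots> = coeff (decode (c' d)) d" by simp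
    finally have "c d = \<Phi> (decode (c' d))"
      using decode_gr[of "c' d" d] c'(1) by (simp add: c_def)
    then show "c' d = c d" using c'(1) by (auto simp: gr_def dest!: spec[of _ d])
  qed
  show "\<exists>!c. (\<forall>d. c d \<in> gr d) \<and> finite {d. c d \<noteq> \<zero>\<^bsub>alg\<^esub>} \<and>
      a = finsum alg c {d. c d \<noteq> \<zero>\<^bsub>alg\<^esub>}"
    by (rule ex1I[of _ c]) (use c fin eq sum unique in auto)
qed

lemma coeff_map_act: "g \<in> carrier G \<Longrightarrow> coeff (map_poly (\<tau> g) F) d = \<tau> g (coeff F d)"
  by (simp add: coeff_map_poly act_0)

lemma polys_act: "g \<in> carrier G \<Longrightarrow> F \<in> polys \<Longrightarrow> map_poly (\<tau> g) F \<in> polys"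
  by (simp add: polys_def coeff_map_act act_mem)

lemma act_code: "F \<in> polys \<Longrightarrow> act g (\<Phi> F) = \<Phi> (map_poly (\<tau> g) F)"
  by (auto simp: act_def)

lemma map_act_one: "F \<in> polys \<Longrightarrow> map_poly (\<tau> \<one>) F = F"
  by (intro poly_eqI) (use act_one in \<open>auto simp: coeff_map_act polys_def\<close>)

lemma map_act_comp: "g \<in> carrier G \<Longrightarrow> h \<in> carrier G \<Longrightarrow> F \<in> polys \<Longrightarrow>
    map_poly (\<tau> (g \<otimes> h)) F = map_poly (\<tau> g) (map_poly (\<tau> h) F)"
  by (rule poly_eqI, simp add: coeff_map_act, rule act_comp) (auto simp: polys_def)

lemma map_act_add: "g \<in> carrier G \<Longrightarrow>
    map_poly (\<tau> g) (F + H) = map_poly (\<tau> g) F + map_poly (\<tau> g) H"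
  by (auto intro!: poly_eqI simp: coeff_map_act act_add)

lemma map_act_mult: "g \<in> carrier G \<Longrightarrow>
    map_poly (\<tau> g) (F * H) = map_poly (\<tau> g) F * map_poly (\<tau> g) H"
  by (auto intro!: poly_eqI simp: coeff_map_act coeff_mult act_mult act_sum)

lemma map_act_1: "g \<in> carrier G \<Longrightarrow> map_poly (\<tau> g) 1 = 1"
  by (auto intro!: poly_eqI simp: coeff_map_act act_1 act_0)

lemma map_act_neg: "g \<in> carrier G \<Longrightarrow> map_poly (\<tau> g) (- F) = - map_poly (\<tau> g) F"
  by (auto intro!: poly_eqI simp: coeff_map_act act_neg)

lemma map_act_smult: "g \<in> carrier G \<Longrightarrow>
    map_poly (\<tau> g) (Polynomial.smult (scal c) F) = Polynomial.smult (scal c) (map_poly (\<tau> g) F)"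
  by (auto intro!: poly_eqI simp: coeff_map_act act_mult act_scal)

lemma map_act_monom: "g \<in> carrier G \<Longrightarrow> map_poly (\<tau> g) (monom a d) = monom (\<tau> g a) d"
  by (auto intro!: poly_eqI simp: coeff_map_act act_0)

lemma act_Bij: "g \<in> carrier G \<Longrightarrow> act g \<in> Bij (\<Phi> ` polys)"
proof -
  assume g: "g \<in> carrier G"
  have "act g (act (inv g) x) = x" "act (inv g) (act g x) = x" "act g x \<in> \<Phi> ` polys"
    "act (inv g) x \<in> \<Phi> ` polys" if "x \<in> \<Phi> ` polys" for x
    using that g by (auto simp: act_code polys_act map_act_one simp flip: map_act_comp)
  then have "bij_betw (act g) (\<Phi> ` polys) (\<Phi> ` polys)"
    by (intro bij_betwI[of _ _ _ "act (inv g)"]) auto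
  then show ?thesis by (simp add: Bij_def act_def)
qed

lemma action_alg: "graded_action G alg gr act"
  unfolding graded_action_def
proof (intro conjI ballI allI)
  have "group_hom G (BijGroup (\<Phi> ` polys)) act"
  proof (intro group_hom.intro group_hom_axioms.intro homI)
    show "group G" by (rule group_axioms)
    show "group (BijGroup (\<Phi> ` polys))" by (rule group_BijGroup)
    show "act g \<in> carrier (BijGroup (\<Phi> ` polys))" if "g \<in> carrier G" for g
      using act_Bij[OF that] by (simp add: BijGroup_def)
    show "act (g \<otimes> h) = act g \<otimes>\<^bsub>BijGroup (\<Phi> ` polys)\<^esub> act h"
      if "g \<in> carrier G" "h \<in> carrier G" for g h
      using that act_Bij[of g] act_Bij[of h]
      by (auto simp: BijGroup_def compose_def fun_eq_iff act_code polys_act map_act_comp)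
        (auto simp: act_def)
  qed
  then show "group_action G (carrier alg) act"
    by (simp add: group_action_def)
  fix g assume g: "g \<in> carrier G"
  show "act g \<in> Ring.ring_hom alg alg"
    by (rule ring_hom_memI)
      (use g in \<open>auto simp: act_code polys_act polys_add polys_mult polys_1 map_act_add map_act_mult map_act_1\<close>)
  show "act g \<in> LinearCombinations.module_hom class_ring alg alg"
    using g by (auto simp: LinearCombinations.module_hom_def act_code polys_act polys_add polys_smult
        map_act_add map_act_smult)
  show "act g ` gr d \<subseteq> gr d" for d
    using g by (auto simp: gr_def act_code polys_monom map_act_monom act_mem)
qed

text \<open>By \<open>M_gen\<close> the piece \<open>M (Suc d)\<close> is additively generated by
  products from \<open>M 1\<close> and \<open>M d\<close>, so induction on the degree builds all
  monomials from degrees 0 and 1.\<close>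

lemma gen_degree_alg: "gen_degree alg gr \<le> 1"
proof -
  let ?gen = "generate_ring alg {finsum alg c {..1} |c. \<forall>d\<le>1. c d \<in> gr d}"
  interpret cring alg by (rule cring_alg)
  have "{finsum alg c {..1} |c. \<forall>d\<le>1. c d \<in> gr d} \<subseteq> carrier alg"
  proof safe
    fix c assume "\<forall>d\<le>1. c d \<in> gr d"
    then have "c \<in> {..1} \<rightarrow> carrier alg" using gr_subset by auto
    then show "finsum alg c {..1} \<in> carrier alg" by (rule finsum_closed)
  qed
  then have sub: "?gen \<subseteq> carrier alg"
    by (rule generate_ring_incl)
  define Q where "Q = {F \<in> polys. \<Phi> F \<in> ?gen}"
  have Q_add: "F + H \<in> Q" and Q_mult: "F * H \<in> Q" if "F \<in> Q" "H \<in> Q" for F H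
    using that generate_ring.eng_add[of "\<Phi> F" alg _ "\<Phi> H"]
      generate_ring.eng_mult[of "\<Phi> F" alg _ "\<Phi> H"]
    by (auto simp: Q_def polys_add polys_mult)
  have Q_0: "0 \<in> Q"
    using zero_in_generate by (simp add: Q_def polys_0)
  have low: "monom a d \<in> Q" if "a \<in> M d" "d \<le> 1" for a d
  proof -
    \<comment> \<open>The generating set consists of sums of a component of degree 0 and one of
      degree 1; a single monomial arises by making the other component zero.\<close>
    define c where "c e = \<Phi> (monom (if e = d then a else 0) e)" for e
    have c: "c e \<in> gr e" for e
      using that by (auto simp: c_def gr_def intro: M_0)
    have "finsum alg c {..1} = \<Phi> (\<Sum>e\<le>1. decode (c e))"
      using c gr_subset by (intro finsum_alg) auto
    also have "(\<Sum>e\<le>1. decode (c e)) = monom a d"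
      using that by (auto simp: c_def le_Suc_eq)
    finally have "\<Phi> (monom a d) \<in> ?gen"
      using c by (intro generate_ring.incl) (auto intro!: exI[of _ c])
    then show ?thesis
      using that by (simp add: Q_def polys_monom)
  qed
  have "monom a d \<in> Q" if "a \<in> M d" for a d
    using that
  proof (induction d arbitrary: a)
    case (Suc d)
    have "a \<in> {a. monom a (Suc d) \<in> Q}"
    proof (rule M_gen[OF Suc.prems])
      fix x y assume "x \<in> M 1" "y \<in> M d"
      then show "x * y \<in> {a. monom a (Suc d) \<in> Q}"
        using Q_mult[OF low[of x 1] Suc.IH[of y]] by (simp add: mult_monom)
    qed (use Q_add in \<open>auto simp flip: add_monom\<close>)
    then show ?case by simp
  qed (auto intro: low)
  then have "(\<Sum>d\<in>I. monom (coeff F d) d) \<in> Q" if "F \<in> polys" for F I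
    using that by (induction I rule: infinite_finite_induct) (auto simp: polys_def Q_0 Q_add)
  then have "F \<in> Q" if "F \<in> polys" for F
    using that poly_as_sum_of_monoms[of F] by metis
  then have "?gen = carrier alg"
    using sub by (auto simp: Q_def)
  then show ?thesis
    unfolding gen_degree_def one_enat_def by (intro Inf_lower) blast
qed

section \<open>Generation of the invariants in bounded degree\<close>

definition fixed_polys :: "'r poly set" where
  "fixed_polys = {F \<in> polys. \<forall>g\<in>carrier G. map_poly (\<tau> g) F = F}"

lemma fixed_points_alg: "fixed_points G (carrier alg) act = \<Phi> ` fixed_polys"
  by (auto simp: fixed_points_def fixed_polys_def act_code)

lemma fixed_points_gr:
  "fixed_points G (gr d) act = (\<lambda>a. \<Phi> (monom a d)) ` fixed_points G (M d) \<tau>"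
  by (auto simp: fixed_points_def gr_def act_code polys_monom map_act_monom)

lemma cring_fixed: "cring (alg\<lparr>carrier := \<Phi> ` fixed_polys\<rparr>)"
  by (rule cring_alg_carrier)
    (auto simp: fixed_polys_def polys_0 polys_1 polys_add polys_mult polys_neg map_act_add
      map_act_mult map_act_1 map_act_neg)

text \<open>Turns the bound on the infimum into an induction principle: some \<open>m\<close> below
  \<open>N\<close> belongs to the set whose infimum is taken, and the ring generated by the
  invariants of degree at most \<open>m\<close> lies in every subring \<open>Q\<close> that contains
  them.\<close>

lemma fixed_gen_degree_generates:
  assumes "fixed_gen_degree G alg gr act < N"
  obtains m where "enat m < N"
    "\<And>Q d a. subring_set Q \<Longrightarrow> (\<And>e b. e \<le> m \<Longrightarrow> b \<in> fixed_points G (M e) \<tau> \<Longrightarrow> monom b e \<in> Q) \<Longrightarrow>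
      a \<in> fixed_points G (M d) \<tau> \<Longrightarrow> monom a d \<in> Q"
proof -
  let ?B = "alg\<lparr>carrier := \<Phi> ` fixed_polys\<rparr>"
  interpret cring ?B by (rule cring_fixed)
  obtain m where m: "enat m < N" and gen:
    "generate_ring ?B {finsum ?B c {..m} |c. \<forall>d\<le>m. c d \<in> fixed_points G (gr d) act} =
      \<Phi> ` fixed_polys"
    using assms
    by (auto simp: fixed_gen_degree_def gen_degree_def Inf_less_iff fixed_points_alg
        simp del: alg_simps)
  show thesis
  proof (rule that[OF m])
    fix Q d a
    assume Q: "subring_set Q"
      and Q_low: "\<And>e b. e \<le> m \<Longrightarrow> b \<in> fixed_points G (M e) \<tau> \<Longrightarrow> monom b e \<in> Q"
      and a: "a \<in> fixed_points G (M d) \<tau>"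
    have Q_1: "1 \<in> Q"
      and Q_add: "\<And>F H. F \<in> Q \<Longrightarrow> H \<in> Q \<Longrightarrow> F + H \<in> Q"
      and Q_mult: "\<And>F H. F \<in> Q \<Longrightarrow> H \<in> Q \<Longrightarrow> F * H \<in> Q"
      and Q_neg: "\<And>F. F \<in> Q \<Longrightarrow> - F \<in> Q"
      using Q by (auto simp: subring_set_def)
    have Q_0: "0 \<in> Q" using Q_add[OF Q_1 Q_neg[OF Q_1]] by simp
    have Q_sum: "(\<And>i. i \<in> I \<Longrightarrow> f i \<in> Q) \<Longrightarrow> sum f I \<in> Q" for I and f :: "nat \<Rightarrow> 'r poly"
      by (induction I rule: infinite_finite_induct) (auto intro: Q_0 Q_add)
    \<comment> \<open>Membership in the carrier is carried along because the additive inverse of the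
      record is known to decode to the negative only there.\<close>
    have "decode x \<in> Q \<and> x \<in> \<Phi> ` fixed_polys"
      if "x \<in> generate_ring ?B {finsum ?B c {..m} |c. \<forall>d\<le>m. c d \<in> fixed_points G (gr d) act}" for x
      using that
    proof (induction rule: generate_ring.induct)
      case (incl x)
      then obtain c where c: "x = finsum ?B c {..m}" "\<And>d. d \<le> m \<Longrightarrow> c d \<in> fixed_points G (gr d) act"
        by auto
      have "c d \<in> \<Phi> ` fixed_polys" if "d \<le> m" for d
        using c(2)[OF that] by (auto simp: fixed_points_gr fixed_points_def[of _ "M d"] fixed_polys_def polys_monom map_act_monom)
      then have "x = \<Phi> (\<Sum>d\<le>m. decode (c d))"
        unfolding c(1) by (intro finsum_alg_carrier cring_fixed) auto
      moreover have "decode (c d) \<in> Q" if "d \<le> m" for d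
        using c(2)[OF that] Q_low[OF that] by (auto simp: fixed_points_gr)
      ultimately have "decode x \<in> Q" by (auto intro: Q_sum)
      moreover have "x \<in> carrier ?B"
        unfolding c(1) using \<open>\<And>d. d \<le> m \<Longrightarrow> c d \<in> \<Phi> ` fixed_polys\<close> by (intro finsum_closed) auto
      ultimately show ?case by simp
    next
      case (a_inv x)
      then show ?case
        using a_inv_closed[of x] a_inv_alg_carrier[OF cring_fixed] Q_neg
        by (auto simp: fixed_polys_def polys_neg map_act_neg simp del: a_inv_closed)
    next
      case (eng_add x y)
      then show ?case using a_closed[of x y] Q_add by auto
    next
      case (eng_mult x y)
      then show ?case using m_closed[of x y] Q_mult by auto
    qed (use one_closed Q_1 in auto)
    moreover have "monom a d \<in> fixed_polys"
      using a by (auto simp: fixed_points_def fixed_polys_def polys_monom map_act_monom)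
    ultimately show "monom a d \<in> Q"
      unfolding gen by force
  qed
qed

end

subsection \<open>The order of the group is invertible\<close>

text \<open>The target type of \<open>\<Phi>\<close> is the one over which
  \<open>noether_number\<close> ranges, so the algebra built from the data is a member of the family
  in the supremum and inherits its bound. A single \<open>m\<close> serves all \<open>Q\<close> and
  \<open>d\<close>.\<close>

lemma noether_number_generates:
  fixes G :: "('g, 'b) monoid_scheme" (structure) and scal :: "'k::field \<Rightarrow> 'r::comm_ring_1"
    and \<Phi> :: "'r poly \<Rightarrow> (nat \<Rightarrow> 'k) \<Rightarrow> 'k"
  assumes "graded_action_data G scal M \<tau> \<Phi>" and "noether_number TYPE('k) G < N"
  shows "\<exists>m. enat m < N \<and> (\<forall>Q d. subring_set Q \<longrightarrow>
      (\<forall>e\<le>m. \<forall>b\<in>fixed_points G (M e) \<tau>. monom b e \<in> Q) \<longrightarrow>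
      (\<forall>a\<in>fixed_points G (M d) \<tau>. monom a d \<in> Q))"
proof -
  interpret graded_action_data G scal M \<tau> \<Phi> by fact
  have "fixed_gen_degree G alg gr act \<le> noether_number TYPE('k) G"
    unfolding noether_number_def using graded_alg action_alg gen_degree_alg
    by (intro Sup_upper) blast
  then have "fixed_gen_degree G alg gr act < N"
    using assms(2) by (rule order_le_less_trans)
  then show ?thesis
  proof (rule fixed_gen_degree_generates)
    fix m assume m: "enat m < N" and gen: "\<And>Q d a. subring_set Q \<Longrightarrow>
      (\<And>e b. e \<le> m \<Longrightarrow> b \<in> fixed_points G (M e) \<tau> \<Longrightarrow> monom b e \<in> Q) \<Longrightarrow>
      a \<in> fixed_points G (M d) \<tau> \<Longrightarrow> monom a d \<in> Q"
    show ?thesis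
      by (intro exI[of _ m] conjI m allI impI ballI, rule gen) auto
  qed
qed

text \<open>Elements of an infinite field can name natural numbers: through \<open>\<delta>\<close>,
  entries of an argument of type \<open>nat \<Rightarrow> 'k\<close> tell which coefficient to read.
  The encodings \<open>\<Phi>\<close> below are injective for this reason.\<close>

lemma infinite_imp_surj_nat:
  assumes "infinite (UNIV :: 'k set)"
  obtains \<delta> :: "'k \<Rightarrow> nat" where "surj \<delta>"
proof -
  obtain f :: "nat \<Rightarrow> 'k" where "inj f"
    using assms infinite_countable_subset by blast
  then show thesis
    by (intro that[of "inv_into UNIV f"] inj_imp_surj_inv)
qed

lemma of_nat_order_neq_0:
  fixes G :: "('g, 'b) monoid_scheme" (structure)
  assumes inf: "infinite (UNIV :: 'k::field set)" and "group G" and fin: "finite (carrier G)"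
    and noether: "noether_number TYPE('k) G < (if CHAR('k) = 0 then \<infinity> else enat CHAR('k))"
  shows "of_nat (card (carrier G)) \<noteq> (0 :: 'k)"
proof
  interpret group G by fact
  define N where "N = card (carrier G)"
  define p where "p = CHAR('k)"
  assume "of_nat (card (carrier G)) = (0 :: 'k)"
  then have N_0: "of_nat N = (0 :: 'k)" by (simp add: N_def)
  have N_pos: "N > 0"
    using fin one_closed by (auto simp: N_def card_gt_0_iff)
  have p_pos: "p > 0"
    using N_0 N_pos by (auto simp: of_nat_eq_0_iff_char_dvd p_def intro!: Nat.gr0I)
  obtain \<delta> :: "'k \<Rightarrow> nat" where \<delta>: "surj \<delta>"
    using infinite_imp_surj_nat[OF inf] .
  \<comment> \<open>Numbering the group moves coefficient functions from the type of
    \<open>G\<close> to \<open>nat\<close>, where \<open>\<Phi>\<close> can encode them.\<close>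
  obtain idx :: "'g \<Rightarrow> nat" where idx: "bij_betw idx (carrier G) {..<N}"
    using ex_bij_betw_finite_nat[OF fin] by (auto simp: N_def atLeast0LessThan)
  define el where "el = inv_into (carrier G) idx"
  have idx_less: "idx x < N" and el_idx: "el (idx x) = x" if "x \<in> carrier G" for x
    using idx that by (auto simp: el_def bij_betw_def)
  have el_mem: "el i \<in> carrier G" and idx_el: "idx (el i) = i" if "i < N" for i
    using idx that by (auto simp: el_def bij_betw_def inv_into_into f_inv_into_f)
  \<comment> \<open>On indices below \<open>N\<close> this is left multiplication by the inverse of
    \<open>g\<close>. As a map of indices it reverses products, and precomposition reverses them
    again, so \<open>\<tau>\<close> below is a left action.\<close>
  define \<sigma> where "\<sigma> g i = (if i < N then idx (inv g \<otimes> el i) else i)" for g i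
  have \<sigma>_comp: "\<sigma> h (\<sigma> g i) = \<sigma> (g \<otimes> h) i" if "g \<in> carrier G" "h \<in> carrier G" for g h i
    using that by (simp add: \<sigma>_def idx_less el_idx el_mem inv_mult_group m_assoc)
  have \<sigma>_1: "\<sigma> \<one> = id"
    by (auto simp: \<sigma>_def fun_eq_iff el_mem idx_el)
  have \<sigma>_bij: "bij_betw (\<sigma> g) {..<N} {..<N}" if "g \<in> carrier G" for g
  proof (rule bij_betwI[of _ _ _ "\<sigma> (inv g)"])
    show "\<sigma> (inv g) (\<sigma> g i) = i" "\<sigma> g (\<sigma> (inv g) i) = i" for i
      using that by (simp_all add: \<sigma>_comp \<sigma>_1)
  qed (use that in \<open>auto simp: \<sigma>_def idx_less el_mem\<close>)
  \<comment> \<open>The pairs \<open>(a, b)\<close> are encoded as families of power series \<open>a + b i \<epsilon> + \<dots>\<close>, whose higher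
    coefficients are ignored.\<close>
  define M where "M d = {F :: nat \<Rightarrow> 'k fps. \<exists>a. (\<forall>i. fps_nth (F i) 0 = a) \<and> (\<Sum>i<N. fps_nth (F i) 1) = of_nat d * a}"
    for d :: nat
  define \<tau> where "\<tau> g F = (\<lambda>i. F (\<sigma> g i))" for g and F :: "nat \<Rightarrow> 'k fps"
  define scal where "scal c = (\<lambda>i::nat. fps_const c)" for c :: 'k
  \<comment> \<open>The entries 0, 1 and 2 of the argument name the degree, the index in the family
    and the order of the series coefficient, so every coefficient of \<open>F\<close> can be read
    off.\<close>
  define \<Phi> where "\<Phi> F = (\<lambda>x :: nat \<Rightarrow> 'k. fps_nth (coeff F (\<delta> (x 0)) (\<delta> (x 1))) (\<delta> (x 2)))"
    for F :: "(nat \<Rightarrow> 'k fps) poly"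
  have \<tau>_sum: "(\<Sum>i<N. fps_nth (\<tau> g F i) 1) = (\<Sum>i<N. fps_nth (F i) 1)" if "g \<in> carrier G" for g F
    using sum.reindex_bij_betw[OF \<sigma>_bij[OF that], of "\<lambda>i. fps_nth (F i) 1"] by (simp add: \<tau>_def)
  have data: "graded_action_data G scal M \<tau> \<Phi>"
  proof (intro graded_action_data.intro graded_action_data_axioms.intro)
    show "group G" by fact
    show "scal c \<in> M 0" for c
      by (auto simp: scal_def M_def)
    show "a + b \<in> M d" if "a \<in> M d" "b \<in> M d" for a b d
      using that by (auto simp: M_def sum.distrib algebra_simps)
    \<comment> \<open>Product rule: the first coefficients of the product add up to
      \<open>of_nat (i + j)\<close> times the product of the two constant terms.\<close>
    show "a * b \<in> M (i + j)" if "a \<in> M i" "b \<in> M j" for a b i j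
      using that by (auto simp: M_def fps_mult_nth_1 sum.distrib algebra_simps
          simp flip: sum_distrib_left sum_distrib_right)
    show "F \<in> Q" if F: "F \<in> M (Suc d)" and Q: "\<And>x y. x \<in> M 1 \<Longrightarrow> y \<in> M d \<Longrightarrow> x * y \<in> Q"
      for F d Q
    proof -
      \<comment> \<open>\<open>T\<close> is a unit in \<open>M 1\<close>: its constant terms are 1
        and its first coefficients add up to 1. Those of the inverse add up to -1, so multiplying by
        it lowers the degree by one, and every element of \<open>M (Suc d)\<close> is a single
        product \<open>T * y\<close> with \<open>y\<close> in \<open>M d\<close>.\<close>
      define T where "T i = (if i = 0 then 1 + fps_X else 1 :: 'k fps)" for i :: nat
      have "fps_nth (T i) 0 = 1" "fps_nth (T i) (Suc 0) = (if i = 0 then 1 else 0)"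
        "fps_nth (inverse (T i)) 0 = 1" "fps_nth (inverse (T i)) (Suc 0) = (if i = 0 then - 1 else 0)" for i
        by (simp_all add: T_def fps_inverse_fps_X_plus1)
      note T = this
      have "T \<in> M 1"
        using N_pos by (simp add: M_def T)
      moreover have "F * (\<lambda>i. inverse (T i)) \<in> M d"
        using F N_pos
        by (auto simp: M_def T fps_mult_nth_1 sum.distrib algebra_simps if_distrib[of "(*) a" for a]
            cong: if_cong simp flip: sum_distrib_left sum_distrib_right)
      moreover have "F = T * (F * (\<lambda>i. inverse (T i)))"
      proof
        fix i
        have "T i * inverse (T i) = 1"
          by (intro inverse_mult_eq_1') (simp add: T_def)
        then have "F i = (T i * inverse (T i)) * F i" by simp
        then show "F i = (T * (F * (\<lambda>i. inverse (T i)))) i"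
          by (simp add: mult_ac)
      qed
      ultimately show ?thesis using Q by metis
    qed
    show "\<tau> g F \<in> M d" if "g \<in> carrier G" "F \<in> M d" for g F d
      using that \<tau>_sum[of g F] by (auto simp: M_def) (auto simp: \<tau>_def)
    show "inj \<Phi>"
    proof (rule injI, rule poly_eqI, rule ext, rule fps_ext)
      fix F H d i n assume eq: "\<Phi> F = \<Phi> H"
      show "fps_nth (coeff F d i) n = fps_nth (coeff H d i) n"
        using fun_cong[OF eq, of "(\<lambda>j. 0)(0 := inv_into UNIV \<delta> d, 1 := inv_into UNIV \<delta> i, 2 := inv_into UNIV \<delta> n)"]
          surj_f_inv_f[OF \<delta>]
        by (simp add: \<Phi>_def)
    qed
  qed (auto simp: scal_def M_def \<tau>_def \<sigma>_1 \<sigma>_comp fun_eq_iff)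
  obtain m where m: "enat m < (if CHAR('k) = 0 then \<infinity> else enat CHAR('k))"
    and gen: "\<forall>Q d. subring_set Q \<longrightarrow>
      (\<forall>e\<le>m. \<forall>b\<in>fixed_points G (M e) \<tau>. monom b e \<in> Q) \<longrightarrow>
      (\<forall>a\<in>fixed_points G (M d) \<tau>. monom a d \<in> Q)"
    using noether_number_generates[OF data noether] by (elim exE conjE)
  have m_less: "m < p"
    using m p_pos by (simp add: p_def split: if_splits)
  \<comment> \<open>Vanishing constant terms in degrees 1 to \<open>p\<close> define a subring: in
    such a degree \<open>d\<close>, every summand of a product has a factor of positive degree at
    most \<open>d\<close>. Testing index 0 suffices, as the constant terms of an element of
    \<open>M d\<close> do not depend on the index.\<close>
  define Q where "Q = {F :: (nat \<Rightarrow> 'k fps) poly. \<forall>d\<in>{1..p}. fps_nth (coeff F d 0) 0 = 0}"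
  \<comment> \<open>The family 1 is invariant and lies in \<open>M p\<close>: its first coefficients
    add up to 0, which is \<open>p\<close> times 1 in characteristic \<open>p\<close>. Its constant
    terms are 1, so membership in \<open>Q\<close> is absurd.\<close>
  have "monom 1 p \<in> Q"
  proof (rule gen[rule_format])
    have mult: "F * H \<in> Q" if "F \<in> Q" "H \<in> Q" for F H
    proof -
      have "fps_nth (coeff F i 0) 0 * fps_nth (coeff H (d - i) 0) 0 = 0" if "d \<in> {1..p}" "i \<le> d" for d i
        using \<open>F \<in> Q\<close> \<open>H \<in> Q\<close> that by (cases "i = 0") (auto simp: Q_def)
      moreover have "fps_nth ((\<Sum>i\<in>I. f i) 0) 0 = (\<Sum>i\<in>I. fps_nth (f i 0) 0)" for I and f :: "nat \<Rightarrow> nat \<Rightarrow> 'k fps"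
        by (induction I rule: infinite_finite_induct) auto
      ultimately show ?thesis
        by (auto simp: Q_def coeff_mult intro!: sum.neutral)
    qed
    show "subring_set Q"
      using mult by (auto simp: subring_set_def Q_def)
    show "monom b e \<in> Q" if "e \<le> m" "b \<in> fixed_points G (M e) \<tau>" for b e
    proof (cases "e = 0")
      case False
      obtain a where a: "\<And>i. fps_nth (b i) 0 = a" "(\<Sum>i<N. fps_nth (b i) 1) = of_nat e * a"
        using \<open>b \<in> fixed_points G (M e) \<tau>\<close> by (auto simp: M_def fixed_points_def)
      \<comment> \<open>Evaluating the translate by \<open>el i\<close> at \<open>i\<close> reads
        the value at the index of the unit, so an invariant family is constant below
        \<open>N\<close>.\<close>
      have "b i = b (idx \<one>)" if "i < N" for i
      proof -
        have "\<tau> (el i) b i = b i" using that el_mem \<open>b \<in> fixed_points G (M e) \<tau>\<close> by (simp add: fixed_points_def)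
        then show ?thesis using that by (simp add: \<tau>_def \<sigma>_def el_mem)
      qed
      then have "(\<Sum>i<N. fps_nth (b i) 1) = (\<Sum>i<N. fps_nth (b (idx \<one>)) 1)"
        by (intro sum.cong) auto
      \<comment> \<open>A sum of \<open>N\<close> equal terms vanishes since \<open>N\<close> is 0
        in the field; and \<open>e\<close> is invertible because \<open>0 < e < p\<close>.\<close>
      then have "of_nat e * a = 0" using a(2) N_0 by simp
      moreover have "of_nat e \<noteq> (0 :: 'k)"
        using False \<open>e \<le> m\<close> m_less by (auto simp: of_nat_eq_0_iff_char_dvd p_def dest: dvd_imp_le)
      ultimately have "a = 0" by simp
      then show ?thesis using a(1) by (auto simp: Q_def)
    qed (auto simp: Q_def)
  qed (auto simp: Q_def M_def \<tau>_def fixed_points_def p_def fun_eq_iff)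
  then show False using p_pos by (auto simp: Q_def dest!: bspec[of _ _ p])
qed

subsection \<open>Polarization and homogeneous forms\<close>

text \<open>Each element \<open>i\<close> of \<open>I\<close> contributes a difference operator,
  sending \<open>f c\<close> to \<open>f c - f (c + l i)\<close>. Applying all \<open>card I\<close>
  of them to a power of exponent at most \<open>card I\<close> kills lower degrees and turns the top
  power into a multiple of the product.\<close>

lemma alternating_power_sum:
  fixes l :: "'i \<Rightarrow> 'a::comm_ring_1"
  assumes "finite I" "e \<le> card I"
  shows "(\<Sum>S\<in>Pow I. (- 1) ^ card S * (c + sum l S) ^ e) =
    (if e = card I then (- 1) ^ e * of_nat (fact e) * prod l I else 0)"
  using assms
proof (induction I arbitrary: c e rule: finite_induct)
  case (insert i I)
  let ?s = "\<lambda>j. \<Sum>S\<in>Pow I. (- 1) ^ card S * (c + sum l S) ^ j"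
  have "(\<Sum>S\<in>Pow (insert i I). (- 1) ^ card S * (c + sum l S) ^ e) =
      ?s e + (\<Sum>S\<in>Pow I. (- 1) ^ card (insert i S) * (c + sum l (insert i S)) ^ e)"
    unfolding Pow_insert using insert.hyps
    by (subst sum.union_disjoint)
      (auto intro!: arg_cong2[of _ _ _ _ "(+)"] sum.reindex_cong[of "insert i"] inj_onI
        simp: insert_ident)
  also have "(\<Sum>S\<in>Pow I. (- 1) ^ card (insert i S) * (c + sum l (insert i S)) ^ e) =
      (\<Sum>S\<in>Pow I. - ((- 1) ^ card S * (\<Sum>j\<le>e. of_nat (e choose j) * (c + sum l S) ^ j * l i ^ (e - j))))"
  proof (rule sum.cong)
    fix S assume "S \<in> Pow I"
    then have "finite S" "i \<notin> S" using insert.hyps by (auto dest: finite_subset)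
    then show "(- 1) ^ card (insert i S) * (c + sum l (insert i S)) ^ e =
      - ((- 1) ^ card S * (\<Sum>j\<le>e. of_nat (e choose j) * (c + sum l S) ^ j * l i ^ (e - j)))"
      by (simp flip: binomial_ring) (simp add: add_ac)
  qed simp
  also have "\<dots> = - (\<Sum>j\<le>e. of_nat (e choose j) * l i ^ (e - j) * ?s j)"
    unfolding sum_negf sum_distrib_left
    by (subst sum.swap) (simp add: mult_ac)
  \<comment> \<open>The term \<open>j = e\<close> cancels the first sum. The remaining exponents are
    at most \<open>card I\<close>, where the induction hypothesis applies, even if
    \<open>e = Suc (card I)\<close>.\<close>
  also have "\<dots> = - (\<Sum>j<e. of_nat (e choose j) * l i ^ (e - j) * ?s j) - ?s e"
    by (simp add: lessThan_Suc_atMost[symmetric])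
  also have "(\<Sum>j<e. of_nat (e choose j) * l i ^ (e - j) * ?s j) =
      (\<Sum>j<e. if j = card I then of_nat (e choose j) * l i ^ (e - j) * ((- 1) ^ j * of_nat (fact j) * prod l I) else 0)"
    using insert by (intro sum.cong) auto
  also have "\<dots> = (if e = Suc (card I) then of_nat e * l i * ((- 1) ^ card I * of_nat (fact (card I)) * prod l I) else 0)"
    using insert.prems insert.hyps by (auto simp: le_Suc_eq)
  finally show ?case
    using insert.hyps by (auto simp: algebra_simps)
qed simp

text \<open>The case \<open>c = 0\<close> and \<open>e = card I\<close>, with the sign moved across.
  Where the factorial is invertible, this expresses a product of linear forms through powers of
  linear forms.\<close>

lemma polarization:
  fixes l :: "'i \<Rightarrow> 'a::comm_ring_1"
  assumes "finite I"
  shows "of_nat (fact (card I)) * prod l I =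
    (\<Sum>S\<in>Pow I. (- 1) ^ (card I + card S) * sum l S ^ card I)"
proof -
  have "of_nat (fact (card I)) * prod l I =
      (- 1) ^ card I * ((- 1) ^ card I * of_nat (fact (card I)) * prod l I)"
    by (simp flip: power_add mult.assoc)
  also have "\<dots> = (- 1) ^ card I * (\<Sum>S\<in>Pow I. (- 1) ^ card S * sum l S ^ card I)"
    using alternating_power_sum[OF assms order_refl, of 0 l] by simp
  finally show ?thesis
    by (simp add: sum_distrib_left power_add mult.assoc)
qed

section \<open>Closure properties of generated function algebras\<close>

lemma alg_gen_add:
  assumes "(\<lambda>w\<in>X. f w) \<in> alg_gen X S" "(\<lambda>w\<in>X. h w) \<in> alg_gen X S"
  shows "(\<lambda>w\<in>X. f w + h w) \<in> alg_gen X S"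
proof -
  have "(\<lambda>w\<in>X. f w + h w) = (\<lambda>w\<in>X. restrict f X w + restrict h X w)" by auto
  then show ?thesis using alg_gen.add[OF assms] by simp
qed

lemma alg_gen_mult:
  assumes "(\<lambda>w\<in>X. f w) \<in> alg_gen X S" "(\<lambda>w\<in>X. h w) \<in> alg_gen X S"
  shows "(\<lambda>w\<in>X. f w * h w) \<in> alg_gen X S"
proof -
  have "(\<lambda>w\<in>X. f w * h w) = (\<lambda>w\<in>X. restrict f X w * restrict h X w)" by auto
  then show ?thesis using alg_gen.mult[OF assms] by simp
qed

lemma alg_gen_cmult:
  "(\<lambda>w\<in>X. f w) \<in> alg_gen X S \<Longrightarrow> (\<lambda>w\<in>X. c * f w) \<in> alg_gen X S"
  by (intro alg_gen_mult alg_gen.const)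

lemma alg_gen_sum:
  "(\<And>i. i \<in> I \<Longrightarrow> (\<lambda>w\<in>X. f i w) \<in> alg_gen X S) \<Longrightarrow> (\<lambda>w\<in>X. \<Sum>i\<in>I. f i w) \<in> alg_gen X S"
proof (induction I rule: infinite_finite_induct)
  case (insert i I)
  have "(\<lambda>w\<in>X. f i w + (\<Sum>i\<in>I. f i w)) \<in> alg_gen X S"
    using insert by (intro alg_gen_add) blast+
  also have "(\<lambda>w\<in>X. f i w + (\<Sum>i\<in>I. f i w)) = (\<lambda>w\<in>X. \<Sum>i\<in>insert i I. f i w)"
    using insert.hyps by (intro restrict_ext) simp
  finally show ?case .
qed (simp_all add: alg_gen.const)

lemma alg_gen_power:
  assumes "(\<lambda>w\<in>X. f w) \<in> alg_gen X S"
  shows "(\<lambda>w\<in>X. f w ^ e) \<in> alg_gen X S"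
proof (induction e)
  case (Suc e)
  show ?case using alg_gen_mult[OF assms Suc] by (simp only: power_Suc)
qed (simp only: power_0 alg_gen.const)

text \<open>Composition with \<open>\<phi>\<close> respects constants, sums and products, so only
  generators have to be checked.\<close>

lemma alg_gen_comp:
  assumes "f \<in> alg_gen X S" "\<phi> \<in> Y \<rightarrow> X"
    "\<And>s. s \<in> S \<Longrightarrow> (\<lambda>y\<in>Y. s (\<phi> y)) \<in> alg_gen Y T"
  shows "(\<lambda>y\<in>Y. f (\<phi> y)) \<in> alg_gen Y T"
proof -
  have restrict: "(\<lambda>y\<in>Y. (\<lambda>w\<in>X. h w) (\<phi> y)) = (\<lambda>y\<in>Y. h (\<phi> y))" for h :: "'a \<Rightarrow> 'b"
    using assms(2) by (auto simp: fun_eq_iff)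
  show ?thesis
    using assms(1)
    by (induction rule: alg_gen.induct)
      (simp_all only: restrict assms(3) alg_gen.const alg_gen_add alg_gen_mult)
qed

lemma linear_forms_sum:
  assumes "module class_ring V" "\<And>i. i \<in> I \<Longrightarrow> l i \<in> linear_forms V"
  shows "(\<lambda>v\<in>carrier V. \<Sum>i\<in>I. l i v) \<in> linear_forms V"
proof -
  interpret Module.module class_ring V by fact
  show ?thesis
    using assms(2) by (simp add: linear_forms_def sum.distrib sum_distrib_left)
qed

section \<open>Finite dimensional representations and coordinates\<close>

locale fin_dim_rep = group G
  for G :: "('g, 'b) monoid_scheme" (structure) +
  fixes V :: "('k::field, 'v, 'c) module_scheme" and \<sigma> :: "'g \<Rightarrow> 'v \<Rightarrow> 'v"
  assumes rep: "fd_G_module G V \<sigma>"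
    and finite_group: "finite (carrier G)"
begin

sublocale V: vectorspace class_ring V
  using rep by (simp add: fd_G_module_def)

lemma linear_rep:
  assumes "g \<in> carrier G"
  shows "linear_map class_ring V V (\<sigma> g)"
  using rep assms by (simp add: fd_G_module_def)

lemma rep_hom: "g \<in> carrier G \<Longrightarrow> \<sigma> g \<in> LinearCombinations.module_hom class_ring V V"
  using linear_rep by (simp add: linear_map_def mod_hom_def mod_hom_axioms_def)

lemma rep_mem: "g \<in> carrier G \<Longrightarrow> v \<in> carrier V \<Longrightarrow> \<sigma> g v \<in> carrier V"
  using rep_hom by (auto dest: LinearCombinations.module_hom_closed)

lemma rep_add: "g \<in> carrier G \<Longrightarrow> v \<in> carrier V \<Longrightarrow> w \<in> carrier V \<Longrightarrow>
    \<sigma> g (v \<oplus>\<^bsub>V\<^esub> w) = \<sigma> g v \<oplus>\<^bsub>V\<^esub> \<sigma> g w"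
  by (rule LinearCombinations.module_hom_add[OF rep_hom])

lemma rep_smult: "g \<in> carrier G \<Longrightarrow> v \<in> carrier V \<Longrightarrow> \<sigma> g (c \<odot>\<^bsub>V\<^esub> v) = c \<odot>\<^bsub>V\<^esub> \<sigma> g v"
  by (rule LinearCombinations.module_hom_smult[OF rep_hom]) simp_all

lemma zero_smult: "v \<in> carrier V \<Longrightarrow> 0 \<odot>\<^bsub>V\<^esub> v = \<zero>\<^bsub>V\<^esub>"
  using V.lmult_0[of v] by simp

lemma group_action_rep: "group_action G (carrier V) \<sigma>"
  using rep by (simp add: fd_G_module_def)

lemma rep_one: "v \<in> carrier V \<Longrightarrow> \<sigma> \<one> v = v"
  using group_action.id_eq_one[OF group_action_rep] by (metis restrict_apply')

lemma rep_mult: "g \<in> carrier G \<Longrightarrow> h \<in> carrier G \<Longrightarrow> v \<in> carrier V \<Longrightarrow>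
    \<sigma> (g \<otimes> h) v = \<sigma> g (\<sigma> h v)"
  using group_action.composition_rule[OF group_action_rep] by simp

lemma linear_form_act:
  "g \<in> carrier G \<Longrightarrow> l \<in> linear_forms V \<Longrightarrow> (\<lambda>v\<in>carrier V. l (\<sigma> g v)) \<in> linear_forms V"
  by (auto simp: linear_forms_def rep_mem rep_add rep_smult)

text \<open>Sequences of scalars map onto \<open>V\<close> by linear combinations of a finite
  spanning set. Pulling functions on \<open>V\<close> back along \<open>\<pi>\<close> brings them
  into a type that can be encoded for \<open>noether_number\<close>, whatever the type of
  \<open>V\<close>.\<close>

lemma coordinates:
  obtains \<pi> :: "(nat \<Rightarrow> 'k) \<Rightarrow> 'v" where "range \<pi> = carrier V"
proof -
  obtain A where A: "finite A" "A \<subseteq> carrier V" "V.span A = carrier V"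
    using rep by (auto simp: fd_G_module_def V.fin_dim_def)
  obtain idx :: "'v \<Rightarrow> nat" where idx: "inj_on idx A"
    using A(1) finite_imp_inj_to_nat_seg by blast
  define \<pi> where "\<pi> w = V.lincomb (\<lambda>a. w (idx a)) A" for w
  have span: "carrier V = {V.lincomb a A |a. a \<in> A \<rightarrow> carrier class_ring}"
    using V.finite_span[OF A(1,2)] A(3) by simp
  have "v \<in> range \<pi>" if "v \<in> carrier V" for v
  proof -
    from that obtain a where a: "v = V.lincomb a A" unfolding span by auto
    have "\<pi> (\<lambda>i. a (inv_into A idx i)) = v"
      unfolding \<pi>_def a using idx A(2) by (intro V.lincomb_cong) auto
    then show ?thesis by (metis rangeI)
  qed
  moreover have "range \<pi> \<subseteq> carrier V" unfolding span \<pi>_def by auto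
  ultimately show thesis using that[of \<pi>] by blast
qed

end

section \<open>Homogeneous forms as functions on a type\<close>

inductive_set forms :: "('w \<Rightarrow> 'k::field) set \<Rightarrow> nat \<Rightarrow> ('w \<Rightarrow> 'k) set"
  for L d where
  prod: "length ls = d \<Longrightarrow> set ls \<subseteq> L \<Longrightarrow> (\<lambda>_. c) * prod_list ls \<in> forms L d"
| add: "f \<in> forms L d \<Longrightarrow> h \<in> forms L d \<Longrightarrow> f + h \<in> forms L d"

lemma forms_const: "(\<lambda>_. c) \<in> forms L 0"
proof -
  have "(\<lambda>_. c) * prod_list [] \<in> forms L 0" by (rule forms.prod) simp_all
  also have "(\<lambda>_. c) * prod_list [] = (\<lambda>_. c)" by (simp add: fun_eq_iff)
  finally show ?thesis .
qed

text \<open>Repeating an element of \<open>L\<close> gives a product of length \<open>d\<close> that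
  can be scaled by zero.\<close>

lemma forms_0:
  assumes "l \<in> L"
  shows "0 \<in> forms L d"
proof -
  have "(\<lambda>_. 0) * prod_list (replicate d l) \<in> forms L d"
    using assms by (intro forms.prod) auto
  also have "(\<lambda>_. 0) * prod_list (replicate d l) = 0" by (simp add: fun_eq_iff)
  finally show ?thesis .
qed

lemma form_linear:
  assumes "l \<in> L"
  shows "l \<in> forms L 1"
proof -
  have "(\<lambda>_. 1) * prod_list [l] \<in> forms L 1"
    using assms by (intro forms.prod) auto
  also have "(\<lambda>_. 1) * prod_list [l] = l" by (simp add: fun_eq_iff)
  finally show ?thesis .
qed

lemma forms_mult:
  assumes "f \<in> forms L i" "h \<in> forms L j"
  shows "f * h \<in> forms L (i + j)"
  using assms(1)
proof (induction rule: forms.induct)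
  case (prod ls c)
  show ?case
    using assms(2)
  proof (induction rule: forms.induct)
    case (prod ls' c')
    have "(\<lambda>_. c * c') * prod_list (ls @ ls') \<in> forms L (i + j)"
      using prod \<open>length ls = i\<close> \<open>set ls \<subseteq> L\<close> by (intro forms.prod) auto
    also have "(\<lambda>_. c * c') * prod_list (ls @ ls') =
        (\<lambda>_. c) * prod_list ls * ((\<lambda>_. c') * prod_list ls')"
      by (simp add: fun_eq_iff)
    finally show ?case .
  next
    case (add f h)
    show ?case unfolding distrib_left by (rule forms.add) (fact add.IH)+
  qed
next
  case (add f h)
  show ?case unfolding distrib_right by (rule forms.add) (fact add.IH)+
qed

text \<open>Splits one factor off each product and leaves the scalar with the rest; this supplies
  \<open>M_gen\<close> for forms.\<close>

lemma forms_Suc_induct: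
  assumes "f \<in> forms L (Suc d)" "\<And>x y. x \<in> forms L 1 \<Longrightarrow> y \<in> forms L d \<Longrightarrow> x * y \<in> Q"
    "\<And>x y. x \<in> Q \<Longrightarrow> y \<in> Q \<Longrightarrow> x + y \<in> Q"
  shows "f \<in> Q"
  using assms(1)
proof (induction rule: forms.induct)
  case (prod ls c)
  then obtain l ls' where ls: "ls = l # ls'" by (cases ls) auto
  have "(\<lambda>_. c) * prod_list ls' \<in> forms L d"
    using prod ls by (intro forms.prod) auto
  then have "l * ((\<lambda>_. c) * prod_list ls') \<in> Q"
    using prod ls by (intro assms(2) form_linear) auto
  also have "l * ((\<lambda>_. c) * prod_list ls') = (\<lambda>_. c) * prod_list ls"
    unfolding ls prod_list.Cons by (rule mult.left_commute)
  finally show ?case .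
next
  case (add f h)
  show ?case by (rule assms(3)) (fact add.IH)+
qed

section \<open>Forms on a representation, written in coordinates\<close>

context fin_dim_rep
begin

definition pull_forms :: "('w \<Rightarrow> 'v) \<Rightarrow> ('w \<Rightarrow> 'k) set" where
  "pull_forms \<pi> = {\<lambda>w. l (\<pi> w) |l. l \<in> linear_forms V}"

text \<open>The translate of a function on \<open>V\<close>, expressed in coordinates. The preimage
  picked by \<open>inv_into\<close> is arbitrary, which is harmless for functions that factor
  through \<open>\<pi>\<close>.\<close>

definition pull_act :: "('w \<Rightarrow> 'v) \<Rightarrow> 'g \<Rightarrow> ('w \<Rightarrow> 'k) \<Rightarrow> ('w \<Rightarrow> 'k)" where
  "pull_act \<pi> g F = (\<lambda>w. F (inv_into UNIV \<pi> (\<sigma> (inv g) (\<pi> w))))"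

text \<open>Pulled back forms factor through \<open>\<pi>\<close>, so passing to the chosen preimage
  of the image does not change the value. Hence the unit of \<open>G\<close> acts trivially on
  them.\<close>

lemma section_form:
  fixes \<pi> :: "'w \<Rightarrow> 'v"
  assumes "F \<in> forms (pull_forms \<pi>) d"
  shows "F (inv_into UNIV \<pi> (\<pi> w)) = F w"
  using assms
proof (induction rule: forms.induct)
  case (prod ls c)
  have "prod_list ls (inv_into UNIV \<pi> (\<pi> w)) = prod_list ls w"
    using prod(2) by (induction ls) (auto simp: pull_forms_def f_inv_into_f)
  then show ?case by simp
qed simp

lemma pull_act_mult: "pull_act \<pi> g (F * H) = pull_act \<pi> g F * pull_act \<pi> g H"
  by (simp add: pull_act_def fun_eq_iff)

text \<open>A translated pullback of a linear form is the pullback of the translated linear form,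
  and the action is multiplicative.\<close>

lemma pull_act_forms:
  fixes \<pi> :: "'w \<Rightarrow> 'v"
  assumes "range \<pi> = carrier V" "g \<in> carrier G" "F \<in> forms (pull_forms \<pi>) d"
  shows "pull_act \<pi> g F \<in> forms (pull_forms \<pi>) d"
  using assms(3)
proof (induction rule: forms.induct)
  case (prod ls c)
  have \<pi>: "\<pi> w \<in> carrier V" for w using assms(1) by auto
  have sec: "\<pi> (inv_into UNIV \<pi> v) = v" if "v \<in> carrier V" for v
    using that assms(1) by (simp add: f_inv_into_f)
  have "pull_act \<pi> g l \<in> pull_forms \<pi>" if l: "l \<in> pull_forms \<pi>" for l
  proof -
    obtain l' where l': "l = (\<lambda>w. l' (\<pi> w))" "l' \<in> linear_forms V"
      using l by (auto simp: pull_forms_def)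
    have "pull_act \<pi> g l = (\<lambda>w. (\<lambda>v\<in>carrier V. l' (\<sigma> (inv g) v)) (\<pi> w))"
      using assms(2) by (simp add: pull_act_def l' \<pi> sec rep_mem)
    moreover have "(\<lambda>v\<in>carrier V. l' (\<sigma> (inv g) v)) \<in> linear_forms V"
      using assms(2) l' by (intro linear_form_act) auto
    ultimately show ?thesis
      unfolding pull_forms_def by blast
  qed
  moreover have "pull_act \<pi> g ((\<lambda>_. c) * prod_list ls) = (\<lambda>_. c) * prod_list (map (pull_act \<pi> g) ls)"
    by (induction ls) (auto simp: pull_act_def fun_eq_iff)
  ultimately show ?case using prod by (simp only:) (rule forms.prod, auto)
next
  case (add f h)
  moreover have "pull_act \<pi> g (f + h) = pull_act \<pi> g f + pull_act \<pi> g h"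
    by (simp add: pull_act_def fun_eq_iff)
  ultimately show ?case by (simp only: forms.add)
qed

lemma zero_linear_form: "(\<lambda>v\<in>carrier V. 0) \<in> linear_forms V"
  by (auto simp: linear_forms_def)

text \<open>The polynomial functions on \<open>V\<close> by degree, with the degree recorded by the
  polynomial variable. The encoding reads the degree from \<open>x 0\<close> and the point from the
  other entries. That \<open>\<one>\<close> acts trivially is guaranteed on forms only, which is why
  the locale asks for it on the pieces.\<close>

lemma graded_action_data_forms:
  fixes \<pi> :: "(nat \<Rightarrow> 'k) \<Rightarrow> 'v"
  assumes \<delta>: "surj \<delta>" and \<pi>: "range \<pi> = carrier V"
  shows "graded_action_data G (\<lambda>c _. c) (forms (pull_forms \<pi>)) (pull_act \<pi>)
    (\<lambda>F x. coeff F (\<delta> (x 0)) (\<lambda>i. x (Suc i)))"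
proof (intro graded_action_data.intro graded_action_data_axioms.intro)
  have \<pi>_mem: "\<pi> w \<in> carrier V" for w using \<pi> by auto
  have sec: "\<pi> (inv_into UNIV \<pi> v) = v" if "v \<in> carrier V" for v
    using that \<pi> by (simp add: f_inv_into_f)
  show "group G" by (rule is_group)
  show "0 \<in> forms (pull_forms \<pi>) d" for d
    using zero_linear_form by (intro forms_0) (auto simp: pull_forms_def)
  show "pull_act \<pi> \<one> F = F" if "F \<in> forms (pull_forms \<pi>) d" for F d
    using section_form[OF that] by (simp add: pull_act_def rep_one \<pi>_mem)
  show "pull_act \<pi> (g \<otimes> h) F = pull_act \<pi> g (pull_act \<pi> h F)"
    if "g \<in> carrier G" "h \<in> carrier G" for g h F
    using that by (simp add: pull_act_def sec rep_mem \<pi>_mem inv_mult_group rep_mult)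
  show "inj (\<lambda>F (x :: nat \<Rightarrow> 'k). coeff F (\<delta> (x 0)) (\<lambda>i. x (Suc i)) :: 'k)"
  proof (rule injI, rule poly_eqI, rule ext)
    fix F H :: "((nat \<Rightarrow> 'k) \<Rightarrow> 'k) poly" and d x
    assume eq: "(\<lambda>x. coeff F (\<delta> (x 0)) (\<lambda>i. x (Suc i))) = (\<lambda>x. coeff H (\<delta> (x 0)) (\<lambda>i. x (Suc i)))"
    show "coeff F d x = coeff H d x"
      using fun_cong[OF eq, of "\<lambda>i. case i of 0 \<Rightarrow> inv_into UNIV \<delta> d | Suc j \<Rightarrow> x j"]
        surj_f_inv_f[OF \<delta>] by simp
  qed
  show "a \<in> Q" if "a \<in> forms (pull_forms \<pi>) (Suc d)"
    "\<And>x y. x \<in> forms (pull_forms \<pi>) 1 \<Longrightarrow> y \<in> forms (pull_forms \<pi>) d \<Longrightarrow> x * y \<in> Q"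
    "\<And>x y. x \<in> Q \<Longrightarrow> y \<in> Q \<Longrightarrow> x + y \<in> Q" for a d Q
    using that by (rule forms_Suc_induct)
qed (auto simp: pull_act_mult forms_const fun_eq_iff intro: forms.add forms_mult pull_act_forms[OF \<pi>],
    auto simp: pull_act_def)

end

subsection \<open>Generators of the invariant ring\<close>

lemma fun_sum_apply: "(\<Sum>i\<in>I. f i) w = (\<Sum>i\<in>I. f i w)"
  for f :: "'i \<Rightarrow> 'a \<Rightarrow> 'b::comm_monoid_add"
  by (induction I rule: infinite_finite_induct) auto

inductive_set form_sums :: "('w \<Rightarrow> 'k::field) set \<Rightarrow> ('w \<Rightarrow> 'k) set" for L where
  form: "f \<in> forms L d \<Longrightarrow> f \<in> form_sums L"
| add: "f \<in> form_sums L \<Longrightarrow> h \<in> form_sums L \<Longrightarrow> f + h \<in> form_sums L"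

lemma form_sums_mult:
  assumes "f \<in> form_sums L" "h \<in> form_sums L"
  shows "f * h \<in> form_sums L"
  using assms(1)
proof (induction rule: form_sums.induct)
  case (form f d)
  show ?case
    using assms(2)
  proof (induction rule: form_sums.induct)
    case (form h e)
    show ?case by (rule form_sums.form[OF forms_mult]) fact+
  next
    case (add f' h)
    show ?case unfolding distrib_left by (rule form_sums.add) (fact add.IH)+
  qed
next
  case (add f f')
  show ?case unfolding distrib_right by (rule form_sums.add) (fact add.IH)+
qed

lemma poly_fun_extensional:
  assumes "f \<in> poly_funs V"
  shows "f \<in> extensional (carrier V)"
  using assms unfolding poly_funs_def
proof (induction rule: alg_gen.induct)
  case (incl f)
  then show ?case by (simp add: linear_forms_def)
qed (rule restrict_extensional)+

context fin_dim_rep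
begin

text \<open>Polarization replaces a product of \<open>d\<close> linear forms by \<open>d\<close>-th
  powers of their partial sums, at the cost of dividing by \<open>fact d\<close>. Summing over the
  group then leaves orbit sums of powers, which lie in the algebra by \<open>power\<close>.\<close>

lemma forms_transfer:
  fixes \<pi> :: "'w \<Rightarrow> 'v"
  assumes \<pi>: "range \<pi> = carrier V" and F: "F \<in> forms (pull_forms \<pi>) d"
    and fact: "of_nat (fact d) \<noteq> (0 :: 'k)"
    and power: "\<And>l e. l \<in> linear_forms V \<Longrightarrow>
      (\<lambda>v\<in>carrier V. \<Sum>g\<in>carrier G. l (\<sigma> g v) ^ e) \<in> alg_gen (carrier V) T"
  shows "(\<lambda>v\<in>carrier V. \<Sum>g\<in>carrier G. F (inv_into UNIV \<pi> (\<sigma> g v))) \<in> alg_gen (carrier V) T"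
  using F
proof (induction rule: forms.induct)
  case (prod ls c)
  have sec: "\<pi> (inv_into UNIV \<pi> v) = v" if "v \<in> carrier V" for v
    using that \<pi> by (simp add: f_inv_into_f)
  have "ls \<in> lists ((\<lambda>l w. l (\<pi> w)) ` linear_forms V)"
    using prod by (auto simp: pull_forms_def)
  then obtain ls' where ls': "ls = map (\<lambda>l w. l (\<pi> w)) ls'" "set ls' \<subseteq> linear_forms V"
    unfolding lists_image by auto
  \<comment> \<open>Partial sums of the factors are again linear forms; \<open>a S\<close> collects
    the scalar, the sign and the inverse factorial.\<close>
  define l where "l S = (\<lambda>v\<in>carrier V. \<Sum>i\<in>S. (ls' ! i) v)" for S
  define a where "a S = c / of_nat (fact d) * (- 1) ^ (d + card S)" for S :: "nat set"
  have l: "l S \<in> linear_forms V" if "S \<subseteq> {0..<d}" for S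
    unfolding l_def
  proof (intro linear_forms_sum V.module_axioms)
    fix i assume "i \<in> S"
    then have "i < length ls'" using that prod(1) ls'(1) by auto
    then show "ls' ! i \<in> linear_forms V" using ls'(2) nth_mem by blast
  qed
  have eq: "((\<lambda>_. c) * prod_list ls) (inv_into UNIV \<pi> v) = (\<Sum>S\<in>Pow {0..<d}. a S * l S v ^ d)"
    if v: "v \<in> carrier V" for v
  proof -
    have "prod_list ls w = prod_list (map (\<lambda>l. l (\<pi> w)) ls')" for w
      unfolding ls'(1) by (induction ls') auto
    then have "prod_list ls (inv_into UNIV \<pi> v) = (\<Prod>i=0..<d. (ls' ! i) v)"
      using prod(1) ls'(1) sec[OF v] by (simp add: prod.list_conv_set_nth)
    also have "of_nat (fact d) * \<dots> = (\<Sum>S\<in>Pow {0..<d}. (- 1) ^ (d + card S) * l S v ^ d)"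
      using polarization[of "{0..<d}" "\<lambda>i. (ls' ! i) v"] v by (simp add: l_def)
    finally show ?thesis
      using fact by (simp add: a_def field_simps flip: sum_divide_distrib sum_distrib_left)
  qed
  have "(\<lambda>v\<in>carrier V. \<Sum>S\<in>Pow {0..<d}. a S * (\<Sum>g\<in>carrier G. l S (\<sigma> g v) ^ d)) \<in> alg_gen (carrier V) T"
    by (intro alg_gen_sum alg_gen_cmult power l) auto
  also have "(\<lambda>v\<in>carrier V. \<Sum>S\<in>Pow {0..<d}. a S * (\<Sum>g\<in>carrier G. l S (\<sigma> g v) ^ d)) =
      (\<lambda>v\<in>carrier V. \<Sum>g\<in>carrier G. ((\<lambda>_. c) * prod_list ls) (inv_into UNIV \<pi> (\<sigma> g v)))"
  proof (rule restrict_ext)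
    fix v assume v: "v \<in> carrier V"
    have "(\<Sum>g\<in>carrier G. ((\<lambda>_. c) * prod_list ls) (inv_into UNIV \<pi> (\<sigma> g v))) =
        (\<Sum>g\<in>carrier G. \<Sum>S\<in>Pow {0..<d}. a S * l S (\<sigma> g v) ^ d)"
      by (intro sum.cong refl eq rep_mem v)
    also have "\<dots> = (\<Sum>S\<in>Pow {0..<d}. a S * (\<Sum>g\<in>carrier G. l S (\<sigma> g v) ^ d))"
      unfolding sum_distrib_left by (rule sum.swap)
    finally show "(\<Sum>S\<in>Pow {0..<d}. a S * (\<Sum>g\<in>carrier G. l S (\<sigma> g v) ^ d)) =
        (\<Sum>g\<in>carrier G. ((\<lambda>_. c) * prod_list ls) (inv_into UNIV \<pi> (\<sigma> g v)))" ..
  qed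
  finally show ?case .
next
  case (add f h)
  from alg_gen_add[OF add.IH] show ?case
    by (simp only: plus_fun_apply sum.distrib)
qed

lemma sum_rep_shift:
  fixes f :: "'v \<Rightarrow> 'k"
  assumes "h \<in> carrier G" "v \<in> carrier V"
  shows "(\<Sum>g\<in>carrier G. f (\<sigma> g (\<sigma> h v))) = (\<Sum>g\<in>carrier G. f (\<sigma> g v))"
proof (rule sum.reindex_bij_witness[of _ "\<lambda>g. g \<otimes> inv h" "\<lambda>g. g \<otimes> h"])
  show "f (\<sigma> (g \<otimes> h) v) = f (\<sigma> g (\<sigma> h v))" if "g \<in> carrier G" for g
    using that assms by (simp add: rep_mult)
qed (use assms in \<open>auto simp: m_assoc\<close>)

text \<open>Constants and linear forms pull back to forms of degree 0 and 1, and pulling back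
  respects sums and products.\<close>

lemma poly_fun_form_sums:
  fixes \<pi> :: "'w \<Rightarrow> 'v"
  assumes \<pi>: "range \<pi> = carrier V" and "f \<in> poly_funs V"
  shows "(\<lambda>w. f (\<pi> w)) \<in> form_sums (pull_forms \<pi>)"
  using assms(2) unfolding poly_funs_def
proof (induction rule: alg_gen.induct)
  case (const c)
  have "\<pi> w \<in> carrier V" for w using \<pi> by auto
  then have "(\<lambda>w. (\<lambda>w\<in>carrier V. c) (\<pi> w)) = (\<lambda>_. c)" by simp
  then show ?case using form_sums.form[OF forms_const] by metis
next
  case (incl f)
  show ?case
    by (rule form_sums.form, rule form_linear) (use incl in \<open>auto simp: pull_forms_def\<close>)
next
  case (add f h)
  have "(\<lambda>w. (\<lambda>w\<in>carrier V. f w + h w) (\<pi> w)) = (\<lambda>w. f (\<pi> w)) + (\<lambda>w. h (\<pi> w))"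
    using \<pi> by (auto simp: fun_eq_iff)
  then show ?case using form_sums.add[OF add.IH] by metis
next
  case (mult f h)
  have "(\<lambda>w. (\<lambda>w\<in>carrier V. f w * h w) (\<pi> w)) = (\<lambda>w. f (\<pi> w)) * (\<lambda>w. h (\<pi> w))"
    using \<pi> by (auto simp: fun_eq_iff)
  then show ?case using form_sums_mult[OF mult.IH] by metis
qed

text \<open>Reduces the generation of all invariants to orbit sums of powers of linear forms:
  averaging and polarizing handles degrees up to \<open>m\<close>, the choice of \<open>m\<close>
  handles invariant forms of any degree, and these include the orbit sums of all forms.\<close>

lemma poly_invariants_subset:
  assumes inf: "infinite (UNIV :: 'k set)"
    and noether: "noether_number TYPE('k) G < (if CHAR('k) = 0 then \<infinity> else enat CHAR('k))"
    and power: "\<And>l e. l \<in> linear_forms V \<Longrightarrow>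
      (\<lambda>v\<in>carrier V. \<Sum>g\<in>carrier G. l (\<sigma> g v) ^ e) \<in> alg_gen (carrier V) T"
  shows "poly_invariants G V \<sigma> \<subseteq> alg_gen (carrier V) T"
proof
  obtain \<delta> :: "'k \<Rightarrow> nat" where \<delta>: "surj \<delta>"
    using infinite_imp_surj_nat[OF inf] .
  obtain \<pi> :: "(nat \<Rightarrow> 'k) \<Rightarrow> 'v" where \<pi>: "range \<pi> = carrier V"
    by (rule coordinates)
  define sec where "sec = inv_into UNIV \<pi>"
  have \<pi>_mem: "\<pi> w \<in> carrier V" for w using \<pi> by auto
  have sec: "\<pi> (sec v) = v" if "v \<in> carrier V" for v
    using that \<pi> by (simp add: sec_def f_inv_into_f)
  define M where "M = forms (pull_forms \<pi>)"
  define res where "res F = (\<lambda>v\<in>carrier V. F (sec v))" for F :: "(nat \<Rightarrow> 'k) \<Rightarrow> 'k"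
  let ?B = "alg_gen (carrier V) T"
  define N where "N = (of_nat (card (carrier G)) :: 'k)"
  have N: "N \<noteq> 0"
    unfolding N_def by (rule of_nat_order_neq_0[OF inf is_group finite_group noether])
  obtain m where m: "enat m < (if CHAR('k) = 0 then \<infinity> else enat CHAR('k))"
    and gen: "\<forall>Q d. subring_set Q \<longrightarrow>
      (\<forall>e\<le>m. \<forall>b\<in>fixed_points G (M e) (pull_act \<pi>). monom b e \<in> Q) \<longrightarrow>
      (\<forall>a\<in>fixed_points G (M d) (pull_act \<pi>). monom a d \<in> Q)"
    using noether_number_generates[OF graded_action_data_forms[OF \<delta> \<pi>] noether]
    unfolding M_def by (elim exE conjE)
  \<comment> \<open>In positive characteristic \<open>e\<close> is smaller than the characteristic,
    a prime, which therefore does not divide the factorial.\<close>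
  have fact: "of_nat (fact e) \<noteq> (0 :: 'k)" if "e \<le> m" for e
  proof (cases "CHAR('k) = 0")
    case False
    then have "prime CHAR('k)" by (intro prime_CHAR_semidom) simp
    then show ?thesis
      using m that False by (simp add: of_nat_eq_0_iff_char_dvd prime_dvd_fact_iff)
  qed (simp add: of_nat_eq_0_iff_char_dvd)
  have fixed: "a (sec (\<sigma> g v)) = a (sec v)"
    if "a \<in> fixed_points G (M e) (pull_act \<pi>)" "g \<in> carrier G" "v \<in> carrier V" for a e g v
  proof -
    have "pull_act \<pi> (inv g) a (sec v) = a (sec v)"
      using that by (simp add: fixed_points_def)
    then show ?thesis using that by (simp add: pull_act_def sec flip: sec_def)
  qed
  have low: "res a \<in> ?B" if "e \<le> m" and a: "a \<in> fixed_points G (M e) (pull_act \<pi>)" for a e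
  proof -
    have "(\<lambda>v\<in>carrier V. \<Sum>g\<in>carrier G. a (inv_into UNIV \<pi> (\<sigma> g v))) \<in> ?B"
      using a by (intro forms_transfer[OF \<pi> _ fact[OF that(1)] power])
        (auto simp: fixed_points_def M_def)
    \<comment> \<open>Dividing by the group order turns the orbit sum of an invariant back into the
      invariant.\<close>
    then have "(\<lambda>v\<in>carrier V. inverse N * (\<Sum>g\<in>carrier G. a (sec (\<sigma> g v)))) \<in> ?B"
      unfolding sec_def by (rule alg_gen_cmult)
    also have "(\<lambda>v\<in>carrier V. inverse N * (\<Sum>g\<in>carrier G. a (sec (\<sigma> g v)))) = res a"
      unfolding res_def using fixed[OF a] N by (intro restrict_ext) (simp add: N_def)
    finally show ?thesis .
  qed
  have res_simps: "res 1 = (\<lambda>v\<in>carrier V. 1)" "res (F + H) = (\<lambda>v\<in>carrier V. res F v + res H v)"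
    "res (F * H) = (\<lambda>v\<in>carrier V. res F v * res H v)"
    "res (- F) = (\<lambda>v\<in>carrier V. (- 1) * F (sec v))" for F H
    by (auto simp: res_def fun_eq_iff)
  have homogeneous: "res a \<in> ?B" if a: "a \<in> fixed_points G (M d) (pull_act \<pi>)" for a d
  proof -
    \<comment> \<open>Evaluating the polynomial variable at 1 forgets the grading. Followed by
      \<open>res\<close> this respects the ring operations, so the preimage of the algebra is a
      subring.\<close>
    define Q where "Q = {F :: ((nat \<Rightarrow> 'k) \<Rightarrow> 'k) poly. res (poly F 1) \<in> ?B}"
    have "subring_set Q"
      unfolding subring_set_def Q_def mem_Collect_eq poly_1 poly_minus poly_add poly_mult res_simps
      using alg_gen_cmult[where c = "- 1" and X = "carrier V" and S = T]
      by (auto simp only: res_def intro: alg_gen.const alg_gen.add alg_gen.mult)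
    moreover have "monom b e \<in> Q" if "e \<le> m" "b \<in> fixed_points G (M e) (pull_act \<pi>)" for b e
      using low[OF that] by (simp add: Q_def poly_monom)
    ultimately have "monom a d \<in> Q"
      using gen a by blast
    then show ?thesis by (simp add: Q_def poly_monom)
  qed
  have transfer: "(\<lambda>v\<in>carrier V. \<Sum>g\<in>carrier G. F (sec (\<sigma> g v))) \<in> ?B"
    if "F \<in> form_sums (pull_forms \<pi>)" for F
    using that
  proof (induction rule: form_sums.induct)
    case (form F d)
    interpret graded_action_data G "\<lambda>c _. c" "forms (pull_forms \<pi>)" "pull_act \<pi>"
      "\<lambda>F x. coeff F (\<delta> (x 0)) (\<lambda>i. x (Suc i))"
      by (rule graded_action_data_forms[OF \<delta> \<pi>])
    \<comment> \<open>The orbit sum of a form is an invariant form of the same degree, so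
      \<open>homogeneous\<close> covers it.\<close>
    define a where "a = (\<lambda>w. \<Sum>g\<in>carrier G. F (sec (\<sigma> g (\<pi> w))))"
    have "(\<Sum>g\<in>carrier G. pull_act \<pi> g F) w = a w" for w
    proof -
      have "(\<Sum>g\<in>carrier G. pull_act \<pi> g F) w = (\<Sum>g\<in>carrier G. pull_act \<pi> g F w)"
        by (rule fun_sum_apply)
      \<comment> \<open>\<open>pull_act\<close> translates by the inverse of \<open>g\<close>, so
        the sums agree after inverting the group elements.\<close>
      also have "\<dots> = a w"
        unfolding a_def pull_act_def sec_def[symmetric]
        by (rule sum.reindex_bij_witness[of _ "\<lambda>g. inv g" "\<lambda>g. inv g"]) auto
      finally show ?thesis .
    qed
    then have a_eq: "a = (\<Sum>g\<in>carrier G. pull_act \<pi> g F)" by auto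
    have "a \<in> M d"
      unfolding a_eq M_def by (intro M_sum act_mem form)
    moreover have "pull_act \<pi> g a = a" if "g \<in> carrier G" for g
      using that sum_rep_shift[of "inv g" _ "\<lambda>v. F (sec v)"]
      by (simp add: pull_act_def a_def sec rep_mem \<pi>_mem flip: sec_def)
    ultimately have "res a \<in> ?B"
      by (intro homogeneous) (simp add: fixed_points_def)
    also have "res a = (\<lambda>v\<in>carrier V. \<Sum>g\<in>carrier G. F (sec (\<sigma> g v)))"
      unfolding res_def a_def by (intro restrict_ext) (simp add: sec)
    finally show ?case .
  next
    case (add F H)
    from alg_gen_add[OF add.IH] show ?case
      by (simp only: plus_fun_apply sum.distrib)
  qed
  fix f assume f: "f \<in> poly_invariants G V \<sigma>"
  then have "f \<in> poly_funs V" and inv: "\<And>g v. g \<in> carrier G \<Longrightarrow> v \<in> carrier V \<Longrightarrow> f (\<sigma> g v) = f v"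
    by (auto simp: poly_invariants_def) (metis inv_inv inv_closed)
  \<comment> \<open>The orbit sum of \<open>f\<close> is treated form by form in coordinates;
    invariance makes it \<open>N\<close> times \<open>f\<close>.\<close>
  have "(\<lambda>v\<in>carrier V. \<Sum>g\<in>carrier G. f (\<pi> (sec (\<sigma> g v)))) \<in> ?B"
    by (rule transfer, rule poly_fun_form_sums) fact+
  then have "(\<lambda>v\<in>carrier V. inverse N * (\<Sum>g\<in>carrier G. f (\<pi> (sec (\<sigma> g v))))) \<in> ?B"
    by (rule alg_gen_cmult)
  also have "(\<lambda>v\<in>carrier V. inverse N * (\<Sum>g\<in>carrier G. f (\<pi> (sec (\<sigma> g v))))) = (\<lambda>v\<in>carrier V. f v)"
    using N by (intro restrict_ext) (simp add: sec rep_mem inv N_def)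
  also have "\<dots> = f"
    using \<open>f \<in> poly_funs V\<close> by (intro extensional_restrict poly_fun_extensional)
  finally show "f \<in> ?B" .
qed

end

subsection \<open>Restrictions of polarizations\<close>

text \<open>Stability of the carrier under the action is included so that restricted functions can
  be evaluated at translated points.\<close>

definition equivariant_linear ::
  "('g, 'b) monoid_scheme \<Rightarrow> ('k::field, 'w, 'c) module_scheme \<Rightarrow> ('g \<Rightarrow> 'w \<Rightarrow> 'w) \<Rightarrow>
    ('k, 'u, 'd) module_scheme \<Rightarrow> ('g \<Rightarrow> 'u \<Rightarrow> 'u) \<Rightarrow> ('w \<Rightarrow> 'u) \<Rightarrow> bool" where
  "equivariant_linear G W \<sigma> U \<rho> \<phi> \<longleftrightarrow>
     \<phi> \<in> LinearCombinations.module_hom class_ring W U \<and>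
     (\<forall>g\<in>carrier G. \<forall>w\<in>carrier W. \<sigma> g w \<in> carrier W \<and> \<phi> (\<sigma> g w) = \<rho> g (\<phi> w))"

lemma equivariant_linearD:
  assumes "equivariant_linear G W \<sigma> U \<rho> \<phi>"
  shows "\<phi> \<in> carrier W \<rightarrow> carrier U" "w \<in> carrier W \<Longrightarrow> \<phi> w \<in> carrier U"
    "w \<in> carrier W \<Longrightarrow> w' \<in> carrier W \<Longrightarrow> \<phi> (w \<oplus>\<^bsub>W\<^esub> w') = \<phi> w \<oplus>\<^bsub>U\<^esub> \<phi> w'"
    "w \<in> carrier W \<Longrightarrow> \<phi> (c \<odot>\<^bsub>W\<^esub> w) = c \<odot>\<^bsub>U\<^esub> \<phi> w"
    "g \<in> carrier G \<Longrightarrow> w \<in> carrier W \<Longrightarrow> \<sigma> g w \<in> carrier W"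
    "g \<in> carrier G \<Longrightarrow> w \<in> carrier W \<Longrightarrow> \<phi> (\<sigma> g w) = \<rho> g (\<phi> w)"
  using assms by (auto simp: equivariant_linear_def LinearCombinations.module_hom_def)

lemma poly_fun_comp:
  assumes W: "module class_ring W" and \<phi>: "\<phi> \<in> LinearCombinations.module_hom class_ring W U"
    and f: "f \<in> poly_funs U"
  shows "(\<lambda>w\<in>carrier W. f (\<phi> w)) \<in> poly_funs W"
  using f unfolding poly_funs_def
proof (rule alg_gen_comp)
  interpret Module.module class_ring W by fact
  show "\<phi> \<in> carrier W \<rightarrow> carrier U" by (rule LinearCombinations.module_hom_closed[OF \<phi>])
  show "(\<lambda>w\<in>carrier W. l (\<phi> w)) \<in> alg_gen (carrier W) (linear_forms W)"
    if "l \<in> linear_forms U" for l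
  proof (rule alg_gen.incl)
    show "(\<lambda>w\<in>carrier W. l (\<phi> w)) \<in> linear_forms W"
      using that \<phi> by (auto simp: linear_forms_def LinearCombinations.module_hom_def Pi_iff)
  qed
qed

lemma poly_invariants_comp:
  assumes "group G" "module class_ring W" "equivariant_linear G W \<sigma> U \<rho> \<phi>" "f \<in> poly_invariants G U \<rho>"
  shows "(\<lambda>w\<in>carrier W. f (\<phi> w)) \<in> poly_invariants G W \<sigma>"
proof -
  interpret group G by fact
  have "(\<lambda>w\<in>carrier W. f (\<phi> w)) \<in> poly_funs W"
    using assms by (intro poly_fun_comp[of W \<phi> U]) (auto simp: equivariant_linear_def poly_invariants_def)
  then show ?thesis
    using assms(4) equivariant_linearD[OF assms(3)] by (auto simp: poly_invariants_def)
qed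

lemma poly_invariants_add:
  assumes "f \<in> poly_invariants G W \<sigma>" "h \<in> poly_invariants G W \<sigma>"
    and closed: "\<And>g w. g \<in> carrier G \<Longrightarrow> w \<in> carrier W \<Longrightarrow> \<sigma> g w \<in> carrier W" and "group G"
  shows "(\<lambda>w\<in>carrier W. f w + h w) \<in> poly_invariants G W \<sigma>"
proof -
  interpret group G by fact
  have "(\<lambda>w\<in>carrier W. f w + h w) \<in> poly_funs W"
    using assms(1,2) unfolding poly_invariants_def poly_funs_def by (intro alg_gen.add) auto
  then show ?thesis
    using assms(1,2) closed by (auto simp: poly_invariants_def)
qed

lemma poly_invariants_mult:
  assumes "f \<in> poly_invariants G W \<sigma>" "h \<in> poly_invariants G W \<sigma>"
    and closed: "\<And>g w. g \<in> carrier G \<Longrightarrow> w \<in> carrier W \<Longrightarrow> \<sigma> g w \<in> carrier W" and "group G"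
  shows "(\<lambda>w\<in>carrier W. f w * h w) \<in> poly_invariants G W \<sigma>"
proof -
  interpret group G by fact
  have "(\<lambda>w\<in>carrier W. f w * h w) \<in> poly_funs W"
    using assms(1,2) unfolding poly_invariants_def poly_funs_def by (intro alg_gen.mult) auto
  then show ?thesis
    using assms(1,2) closed by (auto simp: poly_invariants_def)
qed

lemma poly_invariants_const:
  assumes closed: "\<And>g w. g \<in> carrier G \<Longrightarrow> w \<in> carrier W \<Longrightarrow> \<sigma> g w \<in> carrier W" and "group G"
  shows "(\<lambda>w\<in>carrier W. c) \<in> poly_invariants G W \<sigma>"
proof -
  interpret group G by fact
  have "(\<lambda>w\<in>carrier W. c) \<in> poly_funs W"
    unfolding poly_funs_def by (rule alg_gen.const)
  then show ?thesis using closed by (auto simp: poly_invariants_def)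
qed

lemma alg_gen_subset_poly_invariants:
  assumes "S \<subseteq> poly_invariants G W \<sigma>" "group G"
    and "\<And>g w. g \<in> carrier G \<Longrightarrow> w \<in> carrier W \<Longrightarrow> \<sigma> g w \<in> carrier W"
  shows "alg_gen (carrier W) S \<subseteq> poly_invariants G W \<sigma>"
proof
  fix f assume "f \<in> alg_gen (carrier W) S"
  then show "f \<in> poly_invariants G W \<sigma>"
  proof (induction rule: alg_gen.induct)
    case (const c)
    show ?case by (rule poly_invariants_const) (use assms in auto)
  next
    case (add f h)
    show ?case by (rule poly_invariants_add) (use assms add in auto)
  next
    case (mult f h)
    show ?case by (rule poly_invariants_mult) (use assms mult in auto)
  qed (use assms in auto)
qed

lemma equivariant_linear_inv:
  assumes \<alpha>: "\<alpha> \<in> G_Aut G W \<sigma>"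
    and closed: "\<And>g w. g \<in> carrier G \<Longrightarrow> w \<in> carrier W \<Longrightarrow> \<sigma> g w \<in> carrier W"
  shows "equivariant_linear G W \<sigma> W \<sigma> (inv_into (carrier W) \<alpha>)"
proof -
  define \<beta> where "\<beta> = inv_into (carrier W) \<alpha>"
  have bij: "bij_betw \<alpha> (carrier W) (carrier W)"
    and hom: "\<alpha> \<in> LinearCombinations.module_hom class_ring W W"
    and eq: "\<And>g w. g \<in> carrier G \<Longrightarrow> w \<in> carrier W \<Longrightarrow> \<alpha> (\<sigma> g w) = \<sigma> g (\<alpha> w)"
    using \<alpha> by (auto simp: G_Aut_def Bij_def linear_map_def mod_hom_def mod_hom_axioms_def)
  interpret W: vectorspace class_ring W
    using \<alpha> by (simp add: G_Aut_def linear_map_def)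
  have \<beta>: "\<beta> w \<in> carrier W" "\<alpha> (\<beta> w) = w" "\<beta> (\<alpha> w) = w" if "w \<in> carrier W" for w
    using bij that by (auto simp: \<beta>_def bij_betw_def inv_into_into f_inv_into_f)
  \<comment> \<open>Linearity and equivariance of \<open>\<beta>\<close> reduce to those of
    \<open>\<alpha>\<close>: a value of \<open>\<beta>\<close> is identified by applying
    \<open>\<alpha>\<close> to the candidate.\<close>
  have move: "\<beta> y = x" if "x \<in> carrier W" "y = \<alpha> x" for x y
    using that \<beta>(3) by simp
  show ?thesis
    unfolding equivariant_linear_def LinearCombinations.module_hom_def \<beta>_def[symmetric]
    using hom closed eq \<beta>(1,2)
    by (auto intro!: move simp: LinearCombinations.module_hom_def)
qed

lemma Pol_subset_poly_invariants:
  assumes S: "S \<subseteq> poly_invariants G W \<sigma>" and "group G" and W: "module class_ring W"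
    and closed: "\<And>g w. g \<in> carrier G \<Longrightarrow> w \<in> carrier W \<Longrightarrow> \<sigma> g w \<in> carrier W"
  shows "Pol G W \<sigma> S \<subseteq> poly_invariants G W \<sigma>"
proof
  fix f assume "f \<in> Pol G W \<sigma> S"
  then show "f \<in> poly_invariants G W \<sigma>"
  proof (induction rule: Pol.induct)
    case zero
    show ?case by (rule poly_invariants_const) (use assms in auto)
  next
    case (add f h)
    show ?case by (rule poly_invariants_add) (use assms add in auto)
  next
    case (smult f c)
    \<comment> \<open>Scaling is treated as multiplication by a constant invariant.\<close>
    have c: "(\<lambda>w\<in>carrier W. c) \<in> poly_invariants G W \<sigma>"
      by (rule poly_invariants_const) (use assms in auto)
    have "(\<lambda>w\<in>carrier W. (\<lambda>w\<in>carrier W. c) w * f w) \<in> poly_invariants G W \<sigma>"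
      by (rule poly_invariants_mult[OF c smult.IH]) (use assms in auto)
    also have "(\<lambda>w\<in>carrier W. (\<lambda>w\<in>carrier W. c) w * f w) = (\<lambda>w\<in>carrier W. c * f w)"
      by (intro restrict_ext) simp
    finally show ?case .
  next
    case (act f \<alpha>)
    show ?case
      by (rule poly_invariants_comp[OF \<open>group G\<close> W equivariant_linear_inv[OF act.hyps(2) closed] act.IH])
  qed (use assms in auto)
qed

section \<open>The direct sum of two representations\<close>

lemma direct_sum_simps [simp]:
  "carrier (direct_sum U V) = carrier U \<times> carrier V" "\<zero>\<^bsub>direct_sum U V\<^esub> = (\<zero>\<^bsub>U\<^esub>, \<zero>\<^bsub>V\<^esub>)"
  "w \<oplus>\<^bsub>direct_sum U V\<^esub> w' = (fst w \<oplus>\<^bsub>U\<^esub> fst w', snd w \<oplus>\<^bsub>V\<^esub> snd w')"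
  "c \<odot>\<^bsub>direct_sum U V\<^esub> w = (c \<odot>\<^bsub>U\<^esub> fst w, c \<odot>\<^bsub>V\<^esub> snd w)"
  by (simp_all add: direct_sum_def)

locale two_reps = U: fin_dim_rep G U \<rho> + V: fin_dim_rep G V \<sigma>
  for G :: "('g, 'b) monoid_scheme" (structure)
    and U :: "('k::field, 'u) module" and \<rho> and V :: "('k, 'v) module" and \<sigma>
begin

abbreviation W :: "('k, 'u \<times> 'v) module" where
  "W \<equiv> direct_sum U V"

abbreviation \<tau> :: "'g \<Rightarrow> 'u \<times> 'v \<Rightarrow> 'u \<times> 'v" where
  "\<tau> \<equiv> direct_sum_action U \<rho> V \<sigma>"

lemma vectorspace_W: "vectorspace class_ring W"
  by (rule direct_sum_is_vs) (rule U.V.vectorspace_axioms V.V.vectorspace_axioms)+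

lemma module_W: "module class_ring W"
  using vectorspace_W by (simp add: vectorspace_def)

lemma action_W: "g \<in> carrier G \<Longrightarrow> u \<in> carrier U \<Longrightarrow> v \<in> carrier V \<Longrightarrow> \<tau> g (u, v) = (\<rho> g u, \<sigma> g v)"
  by (simp add: direct_sum_action_def)

lemma action_W_closed: "g \<in> carrier G \<Longrightarrow> w \<in> carrier W \<Longrightarrow> \<tau> g w \<in> carrier W"
  by (auto simp: action_W U.rep_mem V.rep_mem)

text \<open>The easy inclusion: \<open>Ext\<close> and \<open>Res\<close> compose with the
  equivariant maps \<open>fst\<close> and \<open>inj2\<close>, and equivariant automorphisms
  preserve invariants.\<close>

lemma Res_Pol_Ext_invariants:
  assumes "S \<subseteq> poly_invariants G U \<rho>"
  shows "Res U V (Pol G W \<tau> (Ext U V S)) \<subseteq> poly_invariants G V \<sigma>"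
proof -
  have "equivariant_linear G W \<tau> U \<rho> fst"
    by (auto simp: equivariant_linear_def LinearCombinations.module_hom_def action_W U.rep_mem V.rep_mem)
  then have "Ext U V S \<subseteq> poly_invariants G W \<tau>"
    using assms poly_invariants_comp[OF U.is_group module_W] unfolding Ext_def by blast
  then have Pol: "Pol G W \<tau> (Ext U V S) \<subseteq> poly_invariants G W \<tau>"
    by (rule Pol_subset_poly_invariants[OF _ U.is_group module_W action_W_closed])
  \<comment> \<open>The embedding of \<open>V\<close> is equivariant because the action fixes the
    zero of \<open>U\<close>.\<close>
  have "\<rho> g \<zero>\<^bsub>U\<^esub> = \<zero>\<^bsub>U\<^esub>" if "g \<in> carrier G" for g
    using U.rep_smult[OF that U.V.M.zero_closed, of 0] U.rep_mem[OF that U.V.M.zero_closed] by (simp add: U.zero_smult)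
  then have "equivariant_linear G V \<sigma> W \<tau> (inj2 U V)"
    by (auto simp: equivariant_linear_def LinearCombinations.module_hom_def inj2_def action_W V.rep_mem)
  then show ?thesis
    using Pol poly_invariants_comp[OF U.is_group V.V.module_axioms] unfolding Res_def by blast
qed

lemma pullback_in_Res_Pol_Ext:
  assumes \<phi>: "equivariant_linear G V \<sigma> U \<rho> \<phi>" and s: "s \<in> S"
  shows "(\<lambda>v\<in>carrier V. s (\<phi> v)) \<in> Res U V (Pol G W \<tau> (Ext U V S))"
proof -
  note \<phi> = equivariant_linearD[OF \<phi>]
  \<comment> \<open>\<open>Pol\<close> acts through the inverse automorphism, so
    \<open>\<alpha>\<close> subtracts \<open>\<phi>\<close> and its inverse \<open>\<beta>\<close>
    adds it. At a point of the summand \<open>V\<close> the first component of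
    \<open>\<beta>\<close> is then \<open>\<phi> v\<close>.\<close>
  define \<alpha> where "\<alpha> = (\<lambda>w\<in>carrier W. (fst w \<oplus>\<^bsub>U\<^esub> (- 1) \<odot>\<^bsub>U\<^esub> \<phi> (snd w), snd w))"
  define \<beta> where "\<beta> w = (fst w \<oplus>\<^bsub>U\<^esub> \<phi> (snd w), snd w)" for w
  have cancel: "(-1) \<odot>\<^bsub>U\<^esub> u \<oplus>\<^bsub>U\<^esub> u = \<zero>\<^bsub>U\<^esub>" "u \<oplus>\<^bsub>U\<^esub> (-1) \<odot>\<^bsub>U\<^esub> u = \<zero>\<^bsub>U\<^esub>" if "u \<in> carrier U" for u
    using U.V.smult_l_distr[of "-1" 1 u] U.V.smult_l_distr[of 1 "-1" u] U.V.smult_one[OF that] that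
    by (simp_all add: U.zero_smult)
  have \<alpha>\<beta>: "\<alpha> (\<beta> w) = w" "\<beta> (\<alpha> w) = w" "\<beta> w \<in> carrier W" "\<alpha> w \<in> carrier W" if "w \<in> carrier W" for w
    using that by (auto simp: \<alpha>_def \<beta>_def \<phi> cancel U.V.M.a_assoc)
  then have bij: "bij_betw \<alpha> (carrier W) (carrier W)"
    by (intro bij_betwI[of _ _ _ \<beta>]) auto
  have inv: "inv_into (carrier W) \<alpha> w = \<beta> w" if "w \<in> carrier W" for w
    using that bij \<alpha>\<beta> by (intro inv_into_f_eq) (auto simp: bij_betw_def)
  have "\<alpha> \<in> G_Aut G W \<tau>"
    unfolding G_Aut_def
  proof (intro CollectI conjI ballI)
    show "\<alpha> \<in> Bij (carrier W)" using bij by (simp add: Bij_def \<alpha>_def)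
    have "\<alpha> \<in> LinearCombinations.module_hom class_ring W W"
      using \<alpha>\<beta>(4)
      by (auto simp: LinearCombinations.module_hom_def \<alpha>_def \<phi> U.V.smult_r_distr U.V.M.a_ac
        U.V.smult_assoc1[symmetric] mult.commute)
    then show "linear_map class_ring W W \<alpha>"
      using vectorspace_W module_W by (simp add: linear_map_def mod_hom_def mod_hom_axioms_def)
    show "\<alpha> (\<tau> g w) = \<tau> g (\<alpha> w)" if "g \<in> carrier G" "w \<in> carrier W" for g w
      using that by (auto simp: \<alpha>_def action_W U.rep_mem V.rep_mem \<phi> U.rep_add U.rep_smult)
  qed
  moreover have "(\<lambda>w\<in>carrier W. s (fst w)) \<in> Ext U V S"
    unfolding Ext_def using s by (rule imageI)
  ultimately have "(\<lambda>w\<in>carrier W. (\<lambda>w\<in>carrier W. s (fst w)) (inv_into (carrier W) \<alpha> w)) \<in> Pol G W \<tau> (Ext U V S)"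
    by (intro Pol.act Pol.incl)
  moreover have "(\<lambda>v\<in>carrier V. s (\<phi> v)) =
      (\<lambda>v\<in>carrier V. (\<lambda>w\<in>carrier W. (\<lambda>w\<in>carrier W. s (fst w)) (inv_into (carrier W) \<alpha> w)) (inj2 U V v))"
  proof (rule restrict_ext)
    fix v assume v: "v \<in> carrier V"
    then have "inj2 U V v \<in> carrier W" "\<beta> (inj2 U V v) = (\<phi> v, v)"
      by (simp_all add: inj2_def \<beta>_def \<phi>)
    then show "s (\<phi> v) =
      (\<lambda>w\<in>carrier W. (\<lambda>w\<in>carrier W. s (fst w)) (inv_into (carrier W) \<alpha> w)) (inj2 U V v)"
      using v \<phi>(2)[OF v] by (simp only: restrict_apply' inv) simp
  qed
  ultimately show ?thesis
    unfolding Res_def by blast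
qed

end

subsection \<open>The regular representation\<close>

lemma regular_module_simps [simp]:
  "carrier (regular_module G :: ('k::field, 'g \<Rightarrow> 'k) module) = carrier G \<rightarrow>\<^sub>E UNIV"
  "\<zero>\<^bsub>regular_module G :: ('k::field, 'g \<Rightarrow> 'k) module\<^esub> = (\<lambda>x\<in>carrier G. 0)"
  "u \<oplus>\<^bsub>regular_module G :: ('k::field, 'g \<Rightarrow> 'k) module\<^esub> v = (\<lambda>x\<in>carrier G. u x + v x)"
  "c \<odot>\<^bsub>regular_module G :: ('k::field, 'g \<Rightarrow> 'k) module\<^esub> v = (\<lambda>x\<in>carrier G. c * v x)"
  by (simp_all add: regular_module_def class_ring.func_space_def)

lemma vectorspace_regular:
  "vectorspace class_ring (regular_module G :: ('k::field, 'g \<Rightarrow> 'k) module)"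
  unfolding vectorspace_def regular_module_def
  by (intro conjI class_cring.func_space_is_module class_field.field_axioms)

lemma fin_dim_regular:
  fixes G :: "('g, 'b) monoid_scheme"
  assumes "finite (carrier G)"
  shows "vectorspace.fin_dim class_ring (regular_module G :: ('k::field, 'g \<Rightarrow> 'k) module)"
proof -
  let ?U = "regular_module G :: ('k, 'g \<Rightarrow> 'k) module"
  interpret U: vectorspace class_ring ?U
    by (rule vectorspace_regular)
  define e where "e x = (\<lambda>y\<in>carrier G. if y = x then 1 else 0 :: 'k)" for x
  have finsum: "finsum ?U h I = (\<lambda>x\<in>carrier G. \<Sum>i\<in>I. h i x)"
    if "finite I" "h \<in> I \<rightarrow> carrier ?U" for h :: "'i \<Rightarrow> 'g \<Rightarrow> 'k" and I
    using that
  proof (induction I rule: finite_induct)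
    case (insert i I)
    then have "finsum ?U h (insert i I) = h i \<oplus>\<^bsub>?U\<^esub> finsum ?U h I"
      by (intro U.M.finsum_insert) auto
    also have "finsum ?U h I = (\<lambda>x\<in>carrier G. \<Sum>i\<in>I. h i x)"
      by (rule insert.IH) (use insert.prems in auto)
    finally show ?case
      using insert.hyps by (simp add: fun_eq_iff)
  qed simp
  have e: "e ` carrier G \<subseteq> carrier ?U"
    by (auto simp: e_def)
  have "inj_on e (carrier G)"
  proof (rule inj_onI)
    fix x y assume x: "x \<in> carrier G" and eq: "e x = e y"
    show "x = y" using fun_cong[OF eq, of x] x by (simp add: e_def split: if_splits)
  qed
  note inj = this
  have "f \<in> U.span (e ` carrier G)" if f: "f \<in> carrier ?U" for f
  proof -
    \<comment> \<open>\<open>lincomb\<close> indexes coefficients by vectors: the delta function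
      \<open>e x\<close> receives the coefficient \<open>f x\<close>, which is well defined as
      \<open>e\<close> is injective.\<close>
    define a where "a u = f (inv_into (carrier G) e u)" for u
    have "U.lincomb a (e ` carrier G) = (\<lambda>y\<in>carrier G. \<Sum>u\<in>e ` carrier G. (a u \<odot>\<^bsub>?U\<^esub> u) y)"
      unfolding U.lincomb_def using assms e by (intro finsum) auto
    also have "\<dots> = (\<lambda>y\<in>carrier G. \<Sum>x\<in>carrier G. f x * e x y)"
      using inj by (intro restrict_ext) (simp add: sum.reindex a_def)
    also have "\<dots> = (\<lambda>y\<in>carrier G. f y)"
    proof (rule restrict_ext)
      fix y assume "y \<in> carrier G"
      then have "(\<Sum>x\<in>carrier G. f x * e x y) = (\<Sum>x\<in>carrier G. if x = y then f y else 0)"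
        by (intro sum.cong) (auto simp: e_def)
      then show "(\<Sum>x\<in>carrier G. f x * e x y) = f y"
        using assms \<open>y \<in> carrier G\<close> by simp
    qed
    also have "\<dots> = f" using f by (simp add: PiE_def extensional_restrict)
    finally have "f = U.lincomb a (e ` carrier G)" ..
    then show ?thesis
      using assms unfolding U.span_def by auto
  qed
  then have "U.span (e ` carrier G) = carrier ?U"
    using U.span_is_subset2[OF e] by blast
  then show ?thesis
    using assms e by (auto simp: U.fin_dim_def)
qed

context group
begin

lemma regular_action_apply:
  "u \<in> carrier (regular_module G) \<Longrightarrow> regular_action G g u = (\<lambda>x\<in>carrier G. u (inv g \<otimes> x))"
  by (simp add: regular_action_def)

lemma regular_action_mult:
  fixes u :: "'a \<Rightarrow> 'k::field"
  assumes "g \<in> carrier G" "h \<in> carrier G" "u \<in> carrier (regular_module G)"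
  shows "regular_action G (g \<otimes> h) u = regular_action G g (regular_action G h u)"
proof -
  have "regular_action G h u \<in> carrier (regular_module G)"
    using assms by (simp add: regular_action_apply)
  then show ?thesis
    using assms by (auto simp: regular_action_apply fun_eq_iff inv_mult_group m_assoc)
qed

lemma regular_action_one:
  fixes u :: "'a \<Rightarrow> 'k::field"
  assumes "u \<in> carrier (regular_module G)"
  shows "regular_action G \<one> u = u"
  using assms by (auto simp: regular_action_apply fun_eq_iff PiE_def extensional_def)

lemma regular_fin_dim_rep:
  assumes "finite (carrier G)"
  shows "fin_dim_rep G (regular_module G :: ('k::field, 'a \<Rightarrow> 'k) module) (regular_action G)"
proof (intro fin_dim_rep.intro fin_dim_rep_axioms.intro)
  let ?U = "regular_module G :: ('k, 'a \<Rightarrow> 'k) module"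
  let ?\<rho> = "regular_action G :: 'a \<Rightarrow> ('a \<Rightarrow> 'k) \<Rightarrow> ('a \<Rightarrow> 'k)"
  show "group G" by (rule is_group)
  have vs: "vectorspace class_ring ?U" by (rule vectorspace_regular)
  have closed: "?\<rho> g u \<in> carrier ?U" if "u \<in> carrier ?U" for g u
    using that by (simp add: regular_action_apply)
  have Bij: "?\<rho> g \<in> Bij (carrier ?U)" if g: "g \<in> carrier G" for g
  proof -
    have "bij_betw (?\<rho> g) (carrier ?U) (carrier ?U)"
    proof (rule bij_betwI[of _ _ _ "?\<rho> (inv g)"])
      show "?\<rho> (inv g) (?\<rho> g u) = u" "?\<rho> g (?\<rho> (inv g) u) = u" if "u \<in> carrier ?U" for u
        using g that regular_action_mult[of "inv g" g u] regular_action_mult[of g "inv g" u]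
          regular_action_one[OF that] by simp_all
    qed (use closed in auto)
    then show ?thesis by (simp add: Bij_def regular_action_def)
  qed
  have "group_hom G (BijGroup (carrier ?U)) ?\<rho>"
  proof (intro group_hom.intro group_hom_axioms.intro homI is_group group_BijGroup)
    show "?\<rho> g \<in> carrier (BijGroup (carrier ?U))" if "g \<in> carrier G" for g
      using Bij[OF that] by (simp add: BijGroup_def)
    fix g h assume gh: "g \<in> carrier G" "h \<in> carrier G"
    show "?\<rho> (g \<otimes> h) = ?\<rho> g \<otimes>\<^bsub>BijGroup (carrier ?U)\<^esub> ?\<rho> h"
    proof
      fix u
      have "?\<rho> (g \<otimes> h) u = compose (carrier ?U) (?\<rho> g) (?\<rho> h) u"
        using regular_action_mult[OF gh, of u]
        by (cases "u \<in> carrier ?U") (simp_all add: compose_def, simp add: regular_action_def)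
      then show "?\<rho> (g \<otimes> h) u = (?\<rho> g \<otimes>\<^bsub>BijGroup (carrier ?U)\<^esub> ?\<rho> h) u"
        using Bij[OF gh(1)] Bij[OF gh(2)] by (simp add: BijGroup_def)
    qed
  qed
  moreover have "?\<rho> g \<in> LinearCombinations.module_hom class_ring ?U ?U" if "g \<in> carrier G" for g
    using that by (auto simp: LinearCombinations.module_hom_def regular_action_apply)
  then have "linear_map class_ring ?U ?U (?\<rho> g)" if "g \<in> carrier G" for g
    using that vs
    by (simp add: linear_map_def mod_hom_def mod_hom_axioms_def vectorspace_def)
  ultimately show "fd_G_module G ?U ?\<rho>"
    using vs fin_dim_regular[OF assms] by (simp add: fd_G_module_def group_action_def)
qed fact

text \<open>The group permutes the coordinates \<open>u x\<close>, hence preserves their power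
  sums.\<close>

lemma power_sum_invariant:
  assumes "finite (carrier G)"
  shows "(\<lambda>u\<in>carrier (regular_module G). \<Sum>x\<in>carrier G. u x ^ e :: 'k::field)
    \<in> poly_invariants G (regular_module G) (regular_action G)"
proof -
  let ?U = "regular_module G :: ('k, 'a \<Rightarrow> 'k) module"
  have "(\<lambda>u\<in>carrier ?U. \<Sum>x\<in>carrier G. u x ^ e) \<in> poly_funs ?U"
    unfolding poly_funs_def
    by (intro alg_gen_sum alg_gen_power alg_gen.incl) (simp add: linear_forms_def PiE_iff)
  moreover have "(\<Sum>x\<in>carrier G. regular_action G (inv g) u x ^ e) = (\<Sum>x\<in>carrier G. u x ^ e)"
    if "g \<in> carrier G" "u \<in> carrier ?U" for g u
    using that
    by (intro sum.reindex_bij_witness[of _ "\<lambda>x. inv g \<otimes> x" "\<lambda>x. g \<otimes> x"])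
      (auto simp: regular_action_apply simp flip: m_assoc)
  moreover have "regular_action G (inv g) u \<in> carrier ?U" if "u \<in> carrier ?U" for g u
    using that by (simp add: regular_action_apply)
  ultimately show ?thesis
    by (simp add: poly_invariants_def)
qed

end

section \<open>Orbit maps to the regular representation and the conclusion\<close>

context fin_dim_rep
begin

text \<open>Equivariance rests on \<open>inv x \<otimes> g = inv (inv g \<otimes> x)\<close>:
  translating \<open>v\<close> by \<open>g\<close> shifts the argument \<open>x\<close>.\<close>

lemma equivariant_to_regular:
  assumes l: "l \<in> linear_forms V"
  shows "equivariant_linear G V \<sigma> (regular_module G) (regular_action G)
    (\<lambda>v. \<lambda>x\<in>carrier G. l (\<sigma> (inv x) v))"
  using l unfolding equivariant_linear_def LinearCombinations.module_hom_def linear_forms_def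
  by (auto simp: rep_mem rep_add rep_smult regular_action_apply inv_mult_group fun_eq_iff
      simp flip: rep_mult)

end

theorem corollary6p5:
  fixes G :: "('g, 'b) monoid_scheme"
  assumes "infinite (UNIV :: 'k::field set)"
    and "group G" and "finite (carrier G)"
    and "(if CHAR('k) = 0 then \<infinity> else enat CHAR('k)) > noether_number TYPE('k) G"
  shows "has_universal_invariants TYPE('v) G
    (regular_module G :: ('k, 'g \<Rightarrow> 'k) module) (regular_action G)"
proof -
  interpret group G by fact
  let ?U = "regular_module G :: ('k, 'g \<Rightarrow> 'k) module"
  interpret U: fin_dim_rep G ?U "regular_action G"
    by (rule regular_fin_dim_rep) fact
  have "alg_gen (carrier V) (Res ?U V (Pol G (direct_sum ?U V)
      (direct_sum_action ?U (regular_action G) V \<sigma>) (Ext ?U V S))) = poly_invariants G V \<sigma>"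
    if V: "fd_G_module G V \<sigma>" and S: "alg_gen (carrier ?U) S = poly_invariants G ?U (regular_action G)"
    for V :: "('k, 'v) module" and \<sigma> S
  proof (rule subset_antisym)
    interpret V: fin_dim_rep G V \<sigma>
      using V assms(3) by unfold_locales
    interpret two_reps G ?U "regular_action G" V \<sigma> ..
    let ?T = "Res ?U V (Pol G W \<tau> (Ext ?U V S))"
    have "S \<subseteq> poly_invariants G ?U (regular_action G)"
      using S alg_gen.incl by blast
    then show "alg_gen (carrier V) ?T \<subseteq> poly_invariants G V \<sigma>"
      by (intro alg_gen_subset_poly_invariants Res_Pol_Ext_invariants is_group V.rep_mem)
    show "poly_invariants G V \<sigma> \<subseteq> alg_gen (carrier V) ?T"
    proof (rule V.poly_invariants_subset[OF assms(1,4)])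
      fix l e assume l: "l \<in> linear_forms V"
      define \<phi> where "\<phi> = (\<lambda>v. \<lambda>x\<in>carrier G. l (\<sigma> (inv\<^bsub>G\<^esub> x) v))"
      note \<phi> = V.equivariant_to_regular[OF l, folded \<phi>_def]
      \<comment> \<open>The power sum is an invariant of the regular representation, so it lies in
        the algebra generated by \<open>S\<close>; its pullback along \<open>\<phi>\<close> is the
        required orbit sum.\<close>
      have "(\<lambda>u\<in>carrier ?U. \<Sum>x\<in>carrier G. u x ^ e) \<in> alg_gen (carrier ?U) S"
        unfolding S by (rule power_sum_invariant) fact
      then have "(\<lambda>v\<in>carrier V. (\<lambda>u\<in>carrier ?U. \<Sum>x\<in>carrier G. u x ^ e) (\<phi> v)) \<in> alg_gen (carrier V) ?T"
      proof (rule alg_gen_comp)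
        show "\<phi> \<in> carrier V \<rightarrow> carrier ?U" by (rule equivariant_linearD[OF \<phi>])
        show "(\<lambda>v\<in>carrier V. s (\<phi> v)) \<in> alg_gen (carrier V) ?T" if "s \<in> S" for s
          by (rule alg_gen.incl, rule pullback_in_Res_Pol_Ext[OF \<phi> that])
      qed
      also have "(\<lambda>v\<in>carrier V. (\<lambda>u\<in>carrier ?U. \<Sum>x\<in>carrier G. u x ^ e) (\<phi> v)) =
          (\<lambda>v\<in>carrier V. \<Sum>g\<in>carrier G. l (\<sigma> g v) ^ e)"
      proof (rule restrict_ext)
        fix v assume "v \<in> carrier V"
        then have "(\<lambda>u\<in>carrier ?U. \<Sum>x\<in>carrier G. u x ^ e) (\<phi> v) = (\<Sum>x\<in>carrier G. \<phi> v x ^ e)"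
          using equivariant_linearD(2)[OF \<phi>] by (simp only: restrict_apply')
        \<comment> \<open>\<open>\<phi> v x\<close> translates by the inverse of \<open>x\<close>,
          so inversion matches the two sums.\<close>
        also have "\<dots> = (\<Sum>g\<in>carrier G. l (\<sigma> g v) ^ e)"
          unfolding \<phi>_def by (rule sum.reindex_bij_witness[of _ "\<lambda>x. inv\<^bsub>G\<^esub> x" "\<lambda>x. inv\<^bsub>G\<^esub> x"]) auto
        finally show "(\<lambda>u\<in>carrier ?U. \<Sum>x\<in>carrier G. u x ^ e) (\<phi> v) = (\<Sum>g\<in>carrier G. l (\<sigma> g v) ^ e)" .
      qed
      finally show "(\<lambda>v\<in>carrier V. \<Sum>g\<in>carrier G. l (\<sigma> g v) ^ e) \<in> alg_gen (carrier V) ?T" .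
    qed
  qed
  then show ?thesis
    using U.rep by (simp add: has_universal_invariants_def)
qed

end
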